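(* Consider the $L$-cell system with $K$ users per cell and $M$-antenna base stations described in the context, with local precoding vectors $\mathbf{w}_{lk}^{*}=(\hat{\mathbf g}_{lk}^{l})^{*}$ (i.e. $\mathbf w_{lk}=\hat{\mathbf g}_{lk}^l$), where $\hat{\mathbf g}_{lk}^{l}=\sqrt{\tau_p\eta}\,\overline{\mathbf R}_{lk}^{l}\mathbf\Psi_{lk}^{-1}\mathbf z_{lk}$ is the LMMSE channel estimate. Then for any given LSFP coefficients $\{a_{lk}^r\}$, the spectral efficiency of user $k$ in cell $l$ is $$R_{lk}=\frac{\tau_c-\tau_p}{\tau_c}\log_2(1+\mathrm{SINR}_{lk}),$$ $$\mathrm{SINR}_{lk}=\frac{|\boldsymbol a_{lk}^H\boldsymbol b_{lk}|^2}{\sum_{r=1}^L\boldsymbol a_{rk}^H\boldsymbol C_{lkk}\boldsymbol a_{rk}-|\boldsymbol a_{lk}^H\boldsymbol b_{lk}|^2+\sum_{r=1}^L\sum_{k'=1,k'\ne k}^K\boldsymbol a_{rk'}^H\boldsymbol C_{lkk'}\boldsymbol a_{rk'}+\sigma^2},$$ where $\boldsymbol a_{lk}=[a_{lk}^1,\dots,a_{lk}^L]^T$, $\boldsymbol b_{lk}=[b_{lk}^1,\dots,b_{lk}^L]^T\in\mathbb C^L$, $\boldsymbol C_{lkk'}\in\mathbb C^{L\times L}$ has $(r,n)$ entry $c_{lkk'}^{rn}$, and these elements are given by $$b_{lk}^{r}=\mathbb E\{(\hat{\mathbf g}_{rk}^r)^H\mathbf g_{lk}^r\}=\tau_p\eta\,\mathrm{tr}\left(\mathbf\Psi_{rk}^{-1}\overline{\mathbf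 R}_{rk}^r\overline{\mathbf R}_{lk}^r\right),$$ $$c_{lkk}^{rr}=\mathbb E\{(\hat{\mathbf g}_{rk}^r)^H\mathbf g_{lk}^r(\mathbf g_{lk}^r)^H\hat{\mathbf g}_{rk}^r\}=\tau_p^2\eta^2\left|\mathrm{tr}\left(\mathbf R_{lk}^r\overline{\mathbf R}_{rk}^r\mathbf\Psi_{rk}^{-1}\right)\right|^2+2\tau_p^2\eta^2\,\Re\left\{(\bar{\mathbf g}_{lk}^r)^H\overline{\mathbf R}_{rk}^r\mathbf\Psi_{rk}^{-1}\bar{\mathbf g}_{lk}^r\,\mathrm{tr}\left(\mathbf\Psi_{rk}^{-1}\overline{\mathbf R}_{rk}^r\mathbf R_{lk}^r\right)\right\}+\tau_p\eta\,\mathrm{tr}\left(\overline{\mathbf R}_{rk}^r\mathbf\Psi_{rk}^{-1}\overline{\mathbf R}_{rk}^r\overline{\mathbf R}_{lk}^r\right),$$ $$c_{lkk}^{rn}=\mathbb E\{(\hat{\mathbf g}_{rk}^r)^H\mathbf g_{lk}^r(\mathbf g_{lk}^n)^H\hat{\mathbf g}_{nk}^n\}=b_{lk}^r(b_{lk}^n)^*,\qquad r\neq n,$$ $$c_{lkk'}^{rr}=\mathbb E\{(\hat{\mathbf g}_{rk'}^r)^H\mathbf g_{lk}^r(\mathbf g_{lk}^r)^H\hat{\mathbf g}_{rk'}^r\}=\tau_p\eta\,\mathrm{tr}\left(\overline{\mathbf R}_{rk'}^r\mathbf\Psi_{rk'}^{-1}\overline{\mathbf R}_{rk'}^r\overline{\mathbf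 R}_{lk}^r\right),\qquad k'\neq k,$$ $$c_{lkk'}^{rn}=\mathbb E\{(\hat{\mathbf g}_{rk'}^r)^H\mathbf g_{lk}^r(\mathbf g_{lk}^n)^H\hat{\mathbf g}_{nk'}^n\}=0,\qquad k'\neq k,\ r\neq n.$$
   Context: Indices: $l,r,n\in\{1,\dots,L\}$ are cells/base stations (BSs), $k,k'\in\{1,\dots,K\}$ are users. $M$ is the number of antennas per BS, $\tau_c$ the coherence block length, $\tau_p=K<\tau_c$ the pilot length, $\eta>0$ the pilot power, $\sigma^2>0$ the noise variance. $^*$ is complex conjugation, $^H$ conjugate transpose, $\mathrm{tr}$ trace, $\Re$ real part. Channels: the channel between user $k$ in cell $l$ and BS $r$ is $\mathbf g_{lk}^r=e^{j\theta_{lk}^r}\bar{\mathbf g}_{lk}^r+\tilde{\mathbf g}_{lk}^r\in\mathbb C^M$, with $\bar{\mathbf g}_{lk}^r\in\mathbb C^M$ deterministic, $\theta_{lk}^r$ uniform on $[0,2\pi)$, and $\tilde{\mathbf g}_{lk}^r\sim\mathcal N_{\mathbb C}(\mathbf 0,\mathbf R_{lk}^r)$ circularly symmetric complex Gaussian with covariance matrix $\mathbf R_{lk}^r\in\mathbb C^{M\times M}$. Pilot observations: users with the same index $k$ in all cells share the same pilot, and distinct pilots are orthogonal, so that BS $l$ obtains $\mathbf z_{lk}=\sqrt{\tau_p\eta}\sum_{r=1}^L\mathbf g_{rk}^l+\tilde{\mathbf n}_{lk}$ with $\tilde{\mathbf n}_{lk}\sim\mathcal N_{\mathbb C}(\mathbf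 0,\sigma^2\mathbf I_M)$. All the random variables $\theta_{lk}^r$, $\tilde{\mathbf g}_{lk}^r$, $\tilde{\mathbf n}_{lk}$ (over all indices) are mutually independent. Define $\overline{\mathbf R}_{lk}^r=\mathbb E\{\mathbf g_{lk}^r(\mathbf g_{lk}^r)^H\}=\mathbf R_{lk}^r+\bar{\mathbf g}_{lk}^r(\bar{\mathbf g}_{lk}^r)^H$ and $\mathbf\Psi_{lk}=\mathbb E\{\mathbf z_{lk}\mathbf z_{lk}^H\}=\tau_p\eta\sum_{r=1}^L\overline{\mathbf R}_{rk}^l+\sigma^2\mathbf I_M$. Two-layer precoding and spectral efficiency: large-scale fading precoding (LSFP) uses deterministic weights $a_{lk}^r\in\mathbb C$ (the conjugate $(a_{lk}^r)^*$ is applied at BS $r$ to the symbol of user $k$ in cell $l$); BS $r$ then uses local precoding vectors $\mathbf w_{rk}^*$, one for each pilot index $k$. The spectral efficiency (SE) of user $k$ in cell $l$ is by definition $R_{lk}=\frac{\tau_c-\tau_p}{\tau_c}\log_2(1+\mathrm{SINR}_{lk})$ with $$\mathrm{SINR}_{lk}=\frac{|\mathrm{DS}_{lk}|^2}{\mathbb E\{|\mathrm{BU}_{lk}|^2\}+\sum_{r\neq l}\mathbb E\{|\mathrm{PC}_{lk}^r|^2\}+\sum_{r=1}^L\sum_{k'\neq k}\mathbb E\{|\mathrm{NI}_{lk}^{rk'}|^2\}+\sigma^2},$$ where $\mathrm{DS}_{lk}=\sum_{r}(a_{lk}^r)^*\mathbb E\{\mathbf w_{rk}^H\mathbf g_{lk}^r\}$,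 $\mathrm{BU}_{lk}=\sum_r(a_{lk}^r)^*(\mathbf w_{rk}^H\mathbf g_{lk}^r-\mathbb E\{\mathbf w_{rk}^H\mathbf g_{lk}^r\})$, $\mathrm{PC}_{lk}^r=\sum_n(a_{rk}^n)^*\mathbf w_{nk}^H\mathbf g_{lk}^n$, $\mathrm{NI}_{lk}^{rk'}=\sum_n(a_{rk'}^n)^*\mathbf w_{nk'}^H\mathbf g_{lk}^n$. In general, for local precoders $\mathbf w$, $b_{lk}^r=\mathbb E\{\mathbf w_{rk}^H\mathbf g_{lk}^r\}$ and $c_{lkk'}^{rn}=\mathbb E\{\mathbf w_{rk'}^H\mathbf g_{lk}^r(\mathbf g_{lk}^n)^H\mathbf w_{nk'}\}$. *)

theory Defs
  imports "HOL-Probability.Probability"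
begin

text \<open>\<open>cdot x y\<close> is $x^H y$ (conjugate-linear in the first argument), \<open>outer x y\<close> is $x y^H$.\<close>

definition cdot :: "complex^'n \<Rightarrow> complex^'n \<Rightarrow> complex"
  where "cdot x y = (\<Sum>i\<in>UNIV. cnj (x $ i) * y $ i)"

definition outer :: "complex^'n \<Rightarrow> complex^'m \<Rightarrow> complex^'m^'n"
  where "outer x y = (\<chi> i j. x $ i * cnj (y $ j))"

text \<open>Degenerate (almost surely constant) variables count as Gaussian, so that singular
  covariance matrices are allowed below.\<close>

definition real_gaussian :: "'w measure \<Rightarrow> ('w \<Rightarrow> real) \<Rightarrow> bool"
  where "real_gaussian P X \<longleftrightarrow> X \<in> borel_measurable P \<and>
    ((\<exists>\<mu>. AE \<omega> in P. X \<omega> = \<mu>) \<or>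
     (\<exists>\<mu> s. s > 0 \<and> distributed P lborel X (normal_density \<mu> s)))"

text \<open>The law $\mathcal N_{\mathbb C}(0, \Sigma)$: every real-linear functional is Gaussian
  (these functionals are exactly the maps $x \mapsto \Re (u^H x)$), the law is invariant under
  multiplication by $e^{j\varphi}$, the mean is zero and the covariance matrix is $\Sigma$.\<close>

definition circ_gaussian ::
  "'w measure \<Rightarrow> ('w \<Rightarrow> complex^'m) \<Rightarrow> complex^'m^'m \<Rightarrow> bool"
  where "circ_gaussian P X \<Sigma> \<longleftrightarrow>
    X \<in> borel_measurable P \<and>
    (\<forall>u. real_gaussian P (\<lambda>\<omega>. Re (cdot u (X \<omega>)))) \<and>
    (\<forall>\<phi>. distr P borel (\<lambda>\<omega>. cis \<phi> *s X \<omega>) = distr P borel X) \<and>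
    (\<integral>\<omega>. X \<omega> \<partial>P) = 0 \<and>
    (\<integral>\<omega>. outer (X \<omega>) (X \<omega>) \<partial>P) = \<Sigma>"

text \<open>The phases are real and the other sources are vectors, so \<open>indep_vars\<close>, which needs one
  common value type, does not apply directly. Mutual independence is stated as \<open>indep_sets\<close> of
  the families of events generated by the individual sources, as in \<open>indep_vars_def2\<close>.\<close>

datatype ('l, 'k) source = Phase 'l 'k 'l | Scatter 'l 'k 'l | Noise 'l 'k

primrec source_events ::
  "'w measure \<Rightarrow> ('l \<Rightarrow> 'k \<Rightarrow> 'l \<Rightarrow> 'w \<Rightarrow> real) \<Rightarrow>
   ('l \<Rightarrow> 'k \<Rightarrow> 'l \<Rightarrow> 'w \<Rightarrow> complex^'m) \<Rightarrow> ('l \<Rightarrow> 'k \<Rightarrow> 'w \<Rightarrow> complex^'m) \<Rightarrow>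
   ('l, 'k) source \<Rightarrow> 'w set set"
  where
    "source_events P \<theta> gt nt (Phase l k r) =
       {\<theta> l k r -` A \<inter> space P | A. A \<in> sets borel}"
  | "source_events P \<theta> gt nt (Scatter l k r) =
       {gt l k r -` A \<inter> space P | A. A \<in> sets borel}"
  | "source_events P \<theta> gt nt (Noise l k) =
       {nt l k -` A \<inter> space P | A. A \<in> sets borel}"

text \<open>Index conventions: \<open>g l k r\<close> is the channel $g_{lk}^r$ between user \<open>k\<close> of cell \<open>l\<close> and base
  station \<open>r\<close>; \<open>w r k\<close> is the local precoder $w_{rk}$ of base station \<open>r\<close> for pilot index \<open>k\<close>;
  \<open>a l k $ r\<close> is the coefficient $a_{lk}^r$. Here \<open>w\<close> is an arbitrary (random) precoder.\<close>

definition b_vec ::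
  "'w measure \<Rightarrow> ('l \<Rightarrow> 'k \<Rightarrow> 'w \<Rightarrow> complex^'m) \<Rightarrow> ('l \<Rightarrow> 'k \<Rightarrow> 'l \<Rightarrow> 'w \<Rightarrow> complex^'m) \<Rightarrow>
   'l \<Rightarrow> 'k \<Rightarrow> complex^'l"
  where "b_vec P w g l k = (\<chi> r. \<integral>\<omega>. cdot (w r k \<omega>) (g l k r \<omega>) \<partial>P)"

definition C_mat ::
  "'w measure \<Rightarrow> ('l \<Rightarrow> 'k \<Rightarrow> 'w \<Rightarrow> complex^'m) \<Rightarrow> ('l \<Rightarrow> 'k \<Rightarrow> 'l \<Rightarrow> 'w \<Rightarrow> complex^'m) \<Rightarrow>
   'l \<Rightarrow> 'k \<Rightarrow> 'k \<Rightarrow> complex^'l^'l"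
  where "C_mat P w g l k k' =
    (\<chi> r n. \<integral>\<omega>. cdot (w r k' \<omega>) (g l k r \<omega>) * cdot (g l k n \<omega>) (w n k' \<omega>) \<partial>P)"

definition DS ::
  "'w measure \<Rightarrow> ('l::finite \<Rightarrow> 'k \<Rightarrow> complex^'l) \<Rightarrow> ('l \<Rightarrow> 'k \<Rightarrow> 'w \<Rightarrow> complex^'m) \<Rightarrow>
   ('l \<Rightarrow> 'k \<Rightarrow> 'l \<Rightarrow> 'w \<Rightarrow> complex^'m) \<Rightarrow> 'l \<Rightarrow> 'k \<Rightarrow> complex"
  where "DS P a w g l k =
    (\<Sum>r\<in>UNIV. cnj (a l k $ r) * (\<integral>\<omega>. cdot (w r k \<omega>) (g l k r \<omega>) \<partial>P))"

definition BU ::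
  "'w measure \<Rightarrow> ('l::finite \<Rightarrow> 'k \<Rightarrow> complex^'l) \<Rightarrow> ('l \<Rightarrow> 'k \<Rightarrow> 'w \<Rightarrow> complex^'m) \<Rightarrow>
   ('l \<Rightarrow> 'k \<Rightarrow> 'l \<Rightarrow> 'w \<Rightarrow> complex^'m) \<Rightarrow> 'l \<Rightarrow> 'k \<Rightarrow> 'w \<Rightarrow> complex"
  where "BU P a w g l k \<omega> =
    (\<Sum>r\<in>UNIV. cnj (a l k $ r) *
      (cdot (w r k \<omega>) (g l k r \<omega>) - (\<integral>\<omega>'. cdot (w r k \<omega>') (g l k r \<omega>') \<partial>P)))"

definition PC ::
  "('l::finite \<Rightarrow> 'k \<Rightarrow> complex^'l) \<Rightarrow> ('l \<Rightarrow> 'k \<Rightarrow> 'w \<Rightarrow> complex^'m) \<Rightarrow>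
   ('l \<Rightarrow> 'k \<Rightarrow> 'l \<Rightarrow> 'w \<Rightarrow> complex^'m) \<Rightarrow> 'l \<Rightarrow> 'k \<Rightarrow> 'l \<Rightarrow> 'w \<Rightarrow> complex"
  where "PC a w g l k r \<omega> =
    (\<Sum>n\<in>UNIV. cnj (a r k $ n) * cdot (w n k \<omega>) (g l k n \<omega>))"

definition NI ::
  "('l::finite \<Rightarrow> 'k \<Rightarrow> complex^'l) \<Rightarrow> ('l \<Rightarrow> 'k \<Rightarrow> 'w \<Rightarrow> complex^'m) \<Rightarrow>
   ('l \<Rightarrow> 'k \<Rightarrow> 'l \<Rightarrow> 'w \<Rightarrow> complex^'m) \<Rightarrow> 'l \<Rightarrow> 'k \<Rightarrow> 'l \<Rightarrow> 'k \<Rightarrow> 'w \<Rightarrow> complex"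
  where "NI a w g l k r k' \<omega> =
    (\<Sum>n\<in>UNIV. cnj (a r k' $ n) * cdot (w n k' \<omega>) (g l k n \<omega>))"

definition SINR ::
  "'w measure \<Rightarrow> real \<Rightarrow> ('l::finite \<Rightarrow> 'k::finite \<Rightarrow> complex^'l) \<Rightarrow>
   ('l \<Rightarrow> 'k \<Rightarrow> 'w \<Rightarrow> complex^'m) \<Rightarrow> ('l \<Rightarrow> 'k \<Rightarrow> 'l \<Rightarrow> 'w \<Rightarrow> complex^'m) \<Rightarrow>
   'l \<Rightarrow> 'k \<Rightarrow> real"
  where "SINR P \<sigma>2 a w g l k =
    (cmod (DS P a w g l k))\<^sup>2 /
    ((\<integral>\<omega>. (cmod (BU P a w g l k \<omega>))\<^sup>2 \<partial>P)
     + (\<Sum>r\<in>UNIV - {l}. \<integral>\<omega>. (cmod (PC a w g l k r \<omega>))\<^sup>2 \<partial>P)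
     + (\<Sum>r\<in>UNIV. \<Sum>k'\<in>UNIV - {k}. \<integral>\<omega>. (cmod (NI a w g l k r k' \<omega>))\<^sup>2 \<partial>P)
     + \<sigma>2)"

definition SE ::
  "'w measure \<Rightarrow> nat \<Rightarrow> nat \<Rightarrow> real \<Rightarrow> ('l::finite \<Rightarrow> 'k::finite \<Rightarrow> complex^'l) \<Rightarrow>
   ('l \<Rightarrow> 'k \<Rightarrow> 'w \<Rightarrow> complex^'m) \<Rightarrow> ('l \<Rightarrow> 'k \<Rightarrow> 'l \<Rightarrow> 'w \<Rightarrow> complex^'m) \<Rightarrow>
   'l \<Rightarrow> 'k \<Rightarrow> real"
  where "SE P \<tau>c \<tau>p \<sigma>2 a w g l k =
    (real \<tau>c - real \<tau>p) / real \<tau>c * log 2 (1 + SINR P \<sigma>2 a w g l k)"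

end

theory Submission
  imports Defs
begin

text \<open>
  Each base station observes $z = s g + y$, where $s^2$ is the pilot energy, $g$ the channel of
  interest and $y$ a zero-mean vector independent of $g$. With $B = \Psi^{-1} \overline R$ the useful
  signal is $s z^H B g$, so only the moments of $g$ of order at most four are needed: Isserlis'
  identity for the scattered part, obtained by polarising the fourth moment of a real Gaussian,
  and $E[e^{j\theta}] = 0$ for the line-of-sight part.
  The factor $\Psi$ that appears in the covariance of $z$ then cancels against $\Psi^{-1}$.
\<close>

subsection \<open>Linear algebra over the complex numbers\<close>

text \<open>The obstacle is that z contains the very channel to be estimated, so the signal is not
  bilinear in independent vectors: it splits into s times the quadratic form g^H B g and the
  bilinear form y^H B g. The first needs true fourth moments, and g is not Gaussian, since the
  random phase gives its line-of-sight part v a constant modulus. Relative to a Gaussian vector with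
  the same covariance S = R + v v^H this costs exactly |v^H B v|^2. With t = tr(B R) and q = v^H B
  v, the Gaussian term |tr(B S)|^2 = |t + q|^2 thus becomes |t + q|^2 - |q|^2 = |t|^2 + 2 Re(conj(q)
  t), the origin of the first two terms of c_{lkk}^{rr}. The other Gaussian term, s^2 tr(B S B^H S),
  is cancelled by the bilinear form, because E[y y^H] = Psi - s^2 S; what survives is tr(B S B^H
  Psi). Between different base stations or different pilots no fourth moment appears: the vectors
  involved depend on disjoint sets of sources.\<close>

lemma cdot_add_right: "cdot u (x + y) = cdot u x + cdot u y"
  by (simp add: cdot_def distrib_left sum.distrib)

lemma cdot_scaleR_right: "cdot u (c *\<^sub>R x) = of_real c * cdot u x"
  by (simp add: cdot_def sum_distrib_left scaleR_conv_of_real[where 'a=complex] mult_ac)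

lemma cdot_add_left: "cdot (u + v) x = cdot u x + cdot v x"
  by (simp add: cdot_def distrib_right sum.distrib)

lemma cdot_scaleR_left: "cdot (c *\<^sub>R u) x = of_real c * cdot u x"
  by (simp add: cdot_def sum_distrib_left scaleR_conv_of_real[where 'a=complex] mult_ac)

lemma cdot_commute: "cdot y x = cnj (cdot x y)"
  by (simp add: cdot_def mult_ac)

lemma cdot_axis: "cdot (axis i c) x = cnj c * x $ i"
proof -
  have "cdot (axis i c) x = (\<Sum>j\<in>UNIV. if j = i then cnj c * x $ j else 0)"
    unfolding cdot_def by (intro sum.cong) (auto simp: axis_def)
  then show ?thesis by simp
qed

definition herm :: "complex^'n^'m \<Rightarrow> complex^'m^'n"
  where "herm A = (\<chi> i j. cnj (A $ j $ i))"

lemma trace_mult: "trace (A ** B) = (\<Sum>i\<in>UNIV. \<Sum>j\<in>UNIV. A $ i $ j * B $ j $ i)"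
  by (simp add: trace_def matrix_matrix_mult_def)

lemma trace_mult4:
  fixes A :: "'a::semiring_1 ^'n^'m" and B :: "'a ^'k^'n" and C :: "'a ^'l^'k" and D :: "'a ^'m^'l"
  shows "trace (A ** B ** C ** D) =
    (\<Sum>i\<in>UNIV. \<Sum>l\<in>UNIV. \<Sum>k\<in>UNIV. \<Sum>j\<in>UNIV. A $ i $ j * B $ j $ k * C $ k $ l * D $ l $ i)"
  by (simp add: trace_def matrix_matrix_mult_def sum_distrib_right)

text \<open>Each summand keeps the two entries of \<open>x\<close> apart from the two entries of
  \<open>y\<close>, so that independence can factorise it. The summation order is that of
  \<open>trace_mult4\<close>, which allows a termwise comparison later.\<close>

lemma cmod2_cdot_mult:
  "cdot y (B *v x) * cnj (cdot y (B *v x)) =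
    (\<Sum>i\<in>UNIV. \<Sum>l\<in>UNIV. \<Sum>k\<in>UNIV. \<Sum>j\<in>UNIV.
       B $ i $ j * cnj (B $ l $ k) * (x $ j * cnj (x $ k) * (y $ l * cnj (y $ i))))"
proof -
  have "cdot y (B *v x) = (\<Sum>i\<in>UNIV. \<Sum>j\<in>UNIV. cnj (y $ i) * (B $ i $ j * x $ j))"
    by (simp add: cdot_def matrix_vector_mult_def sum_distrib_left)
  then have "cdot y (B *v x) * cnj (cdot y (B *v x)) = (\<Sum>i\<in>UNIV. \<Sum>l\<in>UNIV.
      (\<Sum>j\<in>UNIV. cnj (y $ i) * (B $ i $ j * x $ j)) * (\<Sum>k\<in>UNIV. y $ l * (cnj (B $ l $ k) * cnj (x $ k))))"
    by (simp add: sum_product)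
  then show ?thesis
    by (simp add: sum_distrib_left sum_distrib_right mult_ac)
qed

lemma herm_mult: "herm (A ** B) = herm B ** herm A"
  by (simp add: herm_def matrix_matrix_mult_def vec_eq_iff mult.commute)

lemma herm_mat [simp]: "herm (mat 1) = mat 1"
  by (auto simp: herm_def mat_def vec_eq_iff)

lemma herm_herm [simp]: "herm (herm A) = A"
  by (simp add: herm_def vec_eq_iff)

lemma trace_herm: "trace (herm A) = cnj (trace A)"
  by (simp add: trace_def herm_def)

lemma cdot_mult_left: "cdot (A *v y) x = cdot y (herm A *v x)"
proof -
  have "cdot (A *v y) x = (\<Sum>j\<in>UNIV. \<Sum>i\<in>UNIV. cnj (A $ i $ j) * cnj (y $ j) * x $ i)"
    unfolding cdot_def matrix_vector_mult_def by (simp add: sum_distrib_right) (rule sum.swap)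
  then show ?thesis
    by (simp add: cdot_def matrix_vector_mult_def herm_def sum_distrib_left mult_ac)
qed

lemma trace_mult_outer: "trace (B ** outer v v) = cdot v (B *v v)"
  by (simp add: trace_mult outer_def cdot_def matrix_vector_mult_def sum_distrib_left mult_ac)

text \<open>A trivial kernel is the form in which nonsingularity arises from positive definiteness.
  It gives a left inverse, which for a square matrix is two-sided, so the choice hidden in
  \<open>matrix_inv\<close> is justified.\<close>

lemma
  fixes A :: "complex^'n^'n"
  assumes "\<And>v. A *v v = 0 \<Longrightarrow> v = 0"
  shows matrix_inv_mult_left: "matrix_inv A ** A = mat 1" and matrix_inv_mult_right: "A ** matrix_inv A = mat 1"
proof -
  obtain B where "B ** A = mat 1" using assms matrix_left_invertible_ker by blast
  then have "invertible A" using matrix_left_right_inverse unfolding invertible_def by blast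
  then show "matrix_inv A ** A = mat 1" "A ** matrix_inv A = mat 1"
    unfolding matrix_inv_def invertible_def by (metis (mono_tags, lifting) someI_ex)+
qed

text \<open>Transposing and conjugating \<open>A ** matrix_inv A = mat 1\<close> exhibits
  \<open>herm (matrix_inv A)\<close> as a left inverse of \<open>A\<close>; inverses are
  unique.\<close>

lemma herm_matrix_inv:
  assumes "\<And>v. A *v v = 0 \<Longrightarrow> v = 0" and "herm A = A"
  shows "herm (matrix_inv A) = matrix_inv A"
proof -
  have "herm (matrix_inv A) ** A = mat 1"
    using matrix_inv_mult_right[OF assms(1)] herm_mult[of A "matrix_inv A"] assms(2) by simp
  then have "herm (matrix_inv A) ** A ** matrix_inv A = matrix_inv A" by simp
  then show ?thesis
    using matrix_inv_mult_right[OF assms(1)] by (simp flip: matrix_mul_assoc)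
qed

subsection \<open>Measurability and integration\<close>

lemma borel_measurable_cnj [measurable]: "cnj \<in> borel_measurable borel"
  by (intro borel_measurable_continuous_onI continuous_intros)

lemma borel_measurable_vec_nth: "(\<lambda>x::complex^'m. x $ i) \<in> borel_measurable borel"
  by (intro borel_measurable_continuous_onI continuous_intros)

lemma borel_measurable_cis: "cis \<in> borel_measurable borel"
  unfolding cis_conv_exp by (intro borel_measurable_continuous_onI continuous_intros)

text \<open>The events generated by one variable form a pi-system, the condition under which
  independence extends to generated sigma-algebras.\<close>

lemma Int_stable_vimage: "Int_stable {f -` A \<inter> S |A. A \<in> sets M}"
proof (rule Int_stableI)
  fix E F assume "E \<in> {f -` A \<inter> S |A. A \<in> sets M}" "F \<in> {f -` A \<inter> S |A. A \<in> sets M}"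
  then obtain A B where "E = f -` A \<inter> S" "F = f -` B \<inter> S" "A \<in> sets M" "B \<in> sets M"
    by blast
  then show "E \<inter> F \<in> {f -` A \<inter> S |A. A \<in> sets M}"
    by (intro CollectI exI[of _ "A \<inter> B"]) auto
qed

lemma bounded_linear_axis: "bounded_linear (\<lambda>x. axis i x :: 'b::real_normed_vector ^ 'n)"
proof (rule bounded_linear_intro[where K=1])
  show "norm (axis i x :: 'b ^ 'n) \<le> norm x * 1" for x
  proof -
    have "norm (axis i x :: 'b ^ 'n) \<le> (\<Sum>j\<in>UNIV. norm ((axis i x :: 'b ^ 'n) $ j))"
      unfolding norm_vec_def by (rule L2_set_le_sum) simp
    also have "\<dots> = (\<Sum>j\<in>UNIV. if j = i then norm x else 0)"
      by (intro sum.cong) (auto simp: axis_def)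
    finally show ?thesis by simp
  qed
qed (auto simp: axis_def vec_eq_iff)

text \<open>Means and covariances are given as vector- and matrix-valued Bochner integrals, while
  all computations are entrywise. The entry type is a Euclidean space, so that the lemma applies to
  the rows of a matrix and then again to their entries.\<close>

lemma
  fixes f :: "'w \<Rightarrow> 'b::euclidean_space ^ 'n"
  assumes "\<And>i. integrable M (\<lambda>\<omega>. f \<omega> $ i)"
  shows integrable_vec: "integrable M f"
    and integral_vec_nth: "(\<integral>\<omega>. f \<omega> \<partial>M) $ i = (\<integral>\<omega>. f \<omega> $ i \<partial>M)"
proof -
  have eq: "x = (\<Sum>j\<in>UNIV. axis j (x $ j))" for x :: "'b ^ 'n"
    by (simp add: vec_eq_iff axis_def if_distrib cong: if_cong)
  have "integrable M (\<lambda>\<omega>. \<Sum>j\<in>UNIV. axis j (f \<omega> $ j) :: 'b ^ 'n)"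
    by (intro Bochner_Integration.integrable_sum integrable_bounded_linear[OF bounded_linear_axis] assms)
  with eq show int: "integrable M f" by simp
  show "(\<integral>\<omega>. f \<omega> \<partial>M) $ i = (\<integral>\<omega>. f \<omega> $ i \<partial>M)"
    using integral_bounded_linear[OF bounded_linear_vec_nth int, of i] by simp
qed

context prob_space
begin

text \<open>Integrability is not preserved by products, but finiteness of all absolute moments is.
  With this class the integrability of any polynomial in the sources follows from closure rules
  alone.\<close>

definition all_moments :: "('a \<Rightarrow> complex) \<Rightarrow> bool"
  where "all_moments f \<longleftrightarrow> f \<in> borel_measurable M \<and> (\<forall>n. integrable M (\<lambda>\<omega>. cmod (f \<omega>) ^ n))"

lemma all_moments_measurable: "all_moments f \<Longrightarrow> f \<in> borel_measurable M"
  by (simp add: all_moments_def)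

lemma all_moments_integrable: "all_moments f \<Longrightarrow> integrable M f"
  unfolding all_moments_def
  by (rule integrable_norm_cancel) (auto dest: spec[of _ 1])

lemma all_moments_const [simp, intro]: "all_moments (\<lambda>_. c)"
  by (simp add: all_moments_def)

lemma all_moments_bounded:
  assumes [measurable]: "f \<in> borel_measurable M" and "\<And>\<omega>. cmod (f \<omega>) \<le> B"
  shows "all_moments f"
  unfolding all_moments_def
proof (intro conjI allI)
  show "integrable M (\<lambda>\<omega>. cmod (f \<omega>) ^ n)" for n
    by (rule integrable_const_bound[where B="B ^ n"]) (auto intro!: AE_I2 power_mono assms(2))
qed fact

lemma all_moments_cnj [intro]: "all_moments f \<Longrightarrow> all_moments (\<lambda>\<omega>. cnj (f \<omega>))"
  unfolding all_moments_def
  by (auto intro: measurable_compose[OF _ borel_measurable_continuous_onI[OF continuous_on_cnj[OF continuous_on_id]]])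

text \<open>The n-th moment of a product is dominated by the moments of order 2n of its factors,
  through xy \<le> x^2 + y^2; hence the demand for all orders at once.\<close>

lemma all_moments_mult [intro]:
  assumes "all_moments f" "all_moments h"
  shows "all_moments (\<lambda>\<omega>. f \<omega> * h \<omega>)"
  unfolding all_moments_def
proof (intro conjI allI)
  have [measurable]: "f \<in> borel_measurable M" "h \<in> borel_measurable M"
    using assms by (simp_all add: all_moments_def)
  show "(\<lambda>\<omega>. f \<omega> * h \<omega>) \<in> borel_measurable M" by measurable
  fix n
  have "integrable M (\<lambda>\<omega>. cmod (f \<omega>) ^ (2 * n) + cmod (h \<omega>) ^ (2 * n))"
    using assms by (intro Bochner_Integration.integrable_add) (auto simp: all_moments_def)
  then show "integrable M (\<lambda>\<omega>. cmod (f \<omega> * h \<omega>) ^ n)"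
  proof (rule Bochner_Integration.integrable_bound)
    have "x * y \<le> x\<^sup>2 + y\<^sup>2" if "x \<ge> 0" "y \<ge> 0" for x y :: real
    proof -
      have "2 * (x * y) \<le> x\<^sup>2 + y\<^sup>2" using sum_squares_bound[of x y] by simp
      then show ?thesis using that mult_nonneg_nonneg[OF that] by linarith
    qed
    then have "x ^ n * y ^ n \<le> x ^ (2 * n) + y ^ (2 * n)" if "x \<ge> 0" "y \<ge> 0" for x y :: real
      using that by (simp add: power_mult power_mult_distrib mult.commute[of 2])
    then show "AE \<omega> in M. norm (cmod (f \<omega> * h \<omega>) ^ n) \<le> norm (cmod (f \<omega>) ^ (2 * n) + cmod (h \<omega>) ^ (2 * n))"
      by (intro AE_I2) (simp add: norm_mult power_mult_distrib)
  qed measurable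
qed

lemma all_moments_add [intro]:
  assumes "all_moments f" "all_moments h"
  shows "all_moments (\<lambda>\<omega>. f \<omega> + h \<omega>)"
  unfolding all_moments_def
proof (intro conjI allI)
  have [measurable]: "f \<in> borel_measurable M" "h \<in> borel_measurable M"
    using assms by (simp_all add: all_moments_def)
  show "(\<lambda>\<omega>. f \<omega> + h \<omega>) \<in> borel_measurable M" by measurable
  fix n
  have "integrable M (\<lambda>\<omega>. 2 ^ n * (cmod (f \<omega>) ^ n + cmod (h \<omega>) ^ n))"
    using assms by (auto simp: all_moments_def)
  then show "integrable M (\<lambda>\<omega>. cmod (f \<omega> + h \<omega>) ^ n)"
  proof (rule Bochner_Integration.integrable_bound)
    have "cmod (u + v) ^ n \<le> 2 ^ n * (cmod u ^ n + cmod v ^ n)" for u v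
    proof -
      have "cmod (u + v) \<le> 2 * max (cmod u) (cmod v)"
        using norm_triangle_ineq[of u v] by linarith
      then have "cmod (u + v) ^ n \<le> (2 * max (cmod u) (cmod v)) ^ n"
        by (intro power_mono) auto
      also have "\<dots> = 2 ^ n * max (cmod u) (cmod v) ^ n" by (simp add: power_mult_distrib)
      also have "max (cmod u) (cmod v) ^ n \<le> cmod u ^ n + cmod v ^ n"
        by (simp add: max_def)
      finally show ?thesis by simp
    qed
    then show "AE \<omega> in M. norm (cmod (f \<omega> + h \<omega>) ^ n) \<le> norm (2 ^ n * (cmod (f \<omega>) ^ n + cmod (h \<omega>) ^ n))"
      by (intro AE_I2) simp
  qed measurable
qed

lemma all_moments_sum [intro]:
  "(\<And>i. i \<in> I \<Longrightarrow> all_moments (f i)) \<Longrightarrow> all_moments (\<lambda>\<omega>. \<Sum>i\<in>I. f i \<omega>)"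
  by (induction I rule: infinite_finite_induct) auto

lemmas all_moments_intros =
  all_moments_const all_moments_cnj all_moments_mult all_moments_add all_moments_sum

subsection \<open>Gaussian random variables\<close>

lemma real_gaussian_all_moments:
  assumes "real_gaussian M X"
  shows "all_moments (\<lambda>\<omega>. of_real (X \<omega>))"
proof -
  have X [measurable]: "X \<in> borel_measurable M" using assms by (simp add: real_gaussian_def)
  from assms consider c where "AE \<omega> in M. X \<omega> = c"
    | \<mu> s where "s > 0" "distributed M lborel X (normal_density \<mu> s)"
    unfolding real_gaussian_def by blast
  then show ?thesis
  proof cases
    case 1
    have "integrable M (\<lambda>\<omega>. \<bar>X \<omega>\<bar> ^ n)" for n
      using 1 by (subst integrable_cong_AE[where g="\<lambda>_. \<bar>c\<bar> ^ n"]) auto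
    then show ?thesis by (simp add: all_moments_def)
  next
    case 2
    \<comment> \<open>The known bound concerns centred moments; the mean is added back as a constant
      at the end.\<close>
    have "integrable lborel (\<lambda>x. normal_density \<mu> s x * \<bar>x - \<mu>\<bar> ^ n)" for n
      using 2 by (intro integrable_normal_moment_abs)
    then have "integrable M (\<lambda>\<omega>. \<bar>X \<omega> - \<mu>\<bar> ^ n)" for n
      using distributed_integrable[OF 2(2), of "\<lambda>x. \<bar>x - \<mu>\<bar> ^ n"] by simp
    then have "all_moments (\<lambda>\<omega>. of_real (X \<omega> - \<mu>))"
      by (simp add: all_moments_def del: of_real_diff)
    from all_moments_add[OF this all_moments_const[of "of_real \<mu>"]] show ?thesis by simp
  qed
qed

text \<open>The even central moments (2k)! s^(2k) / (2^k k!) give s^2 for k = 1 and 3 s^4 for k = 2.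
  A degenerate variable of mean zero vanishes almost surely, so it obeys the same identity.\<close>

lemma real_gaussian_fourth_moment:
  assumes "real_gaussian M X" and "(\<integral>\<omega>. X \<omega> \<partial>M) = 0"
  shows "(\<integral>\<omega>. X \<omega> ^ 4 \<partial>M) = 3 * (\<integral>\<omega>. (X \<omega>)\<^sup>2 \<partial>M)\<^sup>2"
proof -
  have X [measurable]: "X \<in> borel_measurable M" using assms by (simp add: real_gaussian_def)
  from assms(1) consider c where "AE \<omega> in M. X \<omega> = c"
    | \<mu> s where "s > 0" "distributed M lborel X (normal_density \<mu> s)"
    unfolding real_gaussian_def by blast
  then show ?thesis
  proof cases
    case 1
    have *: "(\<integral>\<omega>. f (X \<omega>) \<partial>M) = f c" if [measurable]: "f \<in> borel_measurable borel" for f :: "real \<Rightarrow> real"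
      using 1 by (subst integral_cong_AE[where g="\<lambda>_. f c"]) (auto simp: prob_space)
    have "c = 0" using *[of "\<lambda>x. x"] assms(2) by simp
    then show ?thesis using *[of "\<lambda>x. x ^ 4"] *[of "\<lambda>x. x\<^sup>2"] by simp
  next
    case 2
    have *: "(\<integral>\<omega>. f (X \<omega>) \<partial>M) = (\<integral>x. normal_density \<mu> s x * f x \<partial>lborel)"
      if "f \<in> borel_measurable borel" for f
      using distributed_integral[OF 2(2), of f] that by simp
    have "\<mu> = 0" using *[of "\<lambda>x. x"] assms(2) integral_normal_moment_nz_1[OF 2(1)] by simp
    have "(\<integral>x. normal_density \<mu> s x * x\<^sup>2 \<partial>lborel) = s\<^sup>2"
      using integral_normal_moment_even[OF 2(1), of 0 1] \<open>\<mu> = 0\<close> by (simp add: power_divide fact_numeral del: power2_eq_square)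
    moreover have "(\<integral>x. normal_density \<mu> s x * x ^ 4 \<partial>lborel) = 3 * (s\<^sup>2)\<^sup>2"
      using integral_normal_moment_even[OF 2(1), of 0 2] \<open>\<mu> = 0\<close> 2(1)
      by (simp add: fact_numeral power_divide field_simps flip: power_mult)
    ultimately show ?thesis
      using *[of "\<lambda>x. x ^ 4"] *[of "\<lambda>x. x\<^sup>2"] by simp
  qed
qed

text \<open>Isserlis' identity for four variables, taken as a predicate because it is linear in each of
  its arguments and hence passes from real Gaussian variables to complex combinations of them.\<close>

definition isserlis :: "('a \<Rightarrow> complex) \<Rightarrow> ('a \<Rightarrow> complex) \<Rightarrow> ('a \<Rightarrow> complex) \<Rightarrow> ('a \<Rightarrow> complex) \<Rightarrow> bool"
  where "isserlis f1 f2 f3 f4 \<longleftrightarrow>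
    all_moments f1 \<and> all_moments f2 \<and> all_moments f3 \<and> all_moments f4 \<and>
    (\<integral>\<omega>. f1 \<omega> * f2 \<omega> * f3 \<omega> * f4 \<omega> \<partial>M) =
      (\<integral>\<omega>. f1 \<omega> * f2 \<omega> \<partial>M) * (\<integral>\<omega>. f3 \<omega> * f4 \<omega> \<partial>M) +
      (\<integral>\<omega>. f1 \<omega> * f3 \<omega> \<partial>M) * (\<integral>\<omega>. f2 \<omega> * f4 \<omega> \<partial>M) +
      (\<integral>\<omega>. f1 \<omega> * f4 \<omega> \<partial>M) * (\<integral>\<omega>. f2 \<omega> * f3 \<omega> \<partial>M)"

text \<open>The three pairings are permuted by a cyclic shift. Linearity in the first argument
  therefore reaches the others by rotation.\<close>

lemma isserlis_rotate: "isserlis f1 f2 f3 f4 \<Longrightarrow> isserlis f2 f3 f4 f1"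
  by (simp add: isserlis_def mult_ac)

lemma isserlis_linear:
  assumes "isserlis f1 f2 f3 f4" "isserlis f1' f2 f3 f4"
  shows "isserlis (\<lambda>\<omega>. f1 \<omega> + c * f1' \<omega>) f2 f3 f4"
proof -
  have m: "all_moments f1" "all_moments f1'" "all_moments f2" "all_moments f3" "all_moments f4"
    using assms by (simp_all add: isserlis_def)
  have lin: "(\<integral>\<omega>. (f1 \<omega> + c * f1' \<omega>) * h \<omega> \<partial>M) = (\<integral>\<omega>. f1 \<omega> * h \<omega> \<partial>M) + c * (\<integral>\<omega>. f1' \<omega> * h \<omega> \<partial>M)"
    if "all_moments h" for h
  proof -
    have "integrable M (\<lambda>\<omega>. f1 \<omega> * h \<omega>)" "integrable M (\<lambda>\<omega>. f1' \<omega> * h \<omega>)"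
      using m that by (auto intro: all_moments_integrable)
    then show ?thesis by (simp add: distrib_right mult.assoc)
  qed
  have "all_moments (\<lambda>\<omega>. f2 \<omega> * (f3 \<omega> * f4 \<omega>))" using m by auto
  note lins = lin[OF this] lin[OF m(3)] lin[OF m(4)] lin[OF m(5)]
  have "all_moments (\<lambda>\<omega>. f1 \<omega> + c * f1' \<omega>)" by (intro all_moments_intros m)
  with assms m show ?thesis
    unfolding isserlis_def mult.assoc lins by (simp add: algebra_simps)
qed

text \<open>Hypothesis \<open>gauss\<close> is joint Gaussianity. In E[Q^4] = 3 (E[Q^2])^2 both
  sides are quartic forms in the coefficients \<open>c1\<close>, ..., \<open>c4\<close>, and the
  claim is equality of their coefficients at the monomial c1 c2 c3 c4.\<close>

lemma isserlis_real_gaussian: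
  fixes X1 X2 X3 X4 :: "'a \<Rightarrow> real"
  assumes gauss: "\<And>c1 c2 c3 c4. real_gaussian M (\<lambda>\<omega>. c1 * X1 \<omega> + c2 * X2 \<omega> + c3 * X3 \<omega> + c4 * X4 \<omega>)"
    and mean: "(\<integral>\<omega>. X1 \<omega> \<partial>M) = 0" "(\<integral>\<omega>. X2 \<omega> \<partial>M) = 0" "(\<integral>\<omega>. X3 \<omega> \<partial>M) = 0" "(\<integral>\<omega>. X4 \<omega> \<partial>M) = 0"
  shows "isserlis (\<lambda>\<omega>. of_real (X1 \<omega>)) (\<lambda>\<omega>. of_real (X2 \<omega>)) (\<lambda>\<omega>. of_real (X3 \<omega>)) (\<lambda>\<omega>. of_real (X4 \<omega>))"
proof -
  have m: "all_moments (\<lambda>\<omega>. of_real (X1 \<omega>))" "all_moments (\<lambda>\<omega>. of_real (X2 \<omega>))"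
    "all_moments (\<lambda>\<omega>. of_real (X3 \<omega>))" "all_moments (\<lambda>\<omega>. of_real (X4 \<omega>))"
    using real_gaussian_all_moments[OF gauss[of 1 0 0 0]] real_gaussian_all_moments[OF gauss[of 0 1 0 0]]
      real_gaussian_all_moments[OF gauss[of 0 0 1 0]] real_gaussian_all_moments[OF gauss[of 0 0 0 1]]
    by simp_all
  have int: "integrable M f" if "all_moments (\<lambda>\<omega>. of_real (f \<omega>))" for f :: "'a \<Rightarrow> real"
    using integrable_Re[OF all_moments_integrable[OF that]] by simp
  have i1: "integrable M X1" "integrable M X2" "integrable M X3" "integrable M X4"
    using m by (auto intro: int)
  define Q where "Q c1 c2 c3 c4 \<omega> = c1 * X1 \<omega> + c2 * X2 \<omega> + c3 * X3 \<omega> + c4 * X4 \<omega>" for c1 c2 c3 c4 \<omega>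
  have Qm: "all_moments (\<lambda>\<omega>. of_real (Q c1 c2 c3 c4 \<omega>))" for c1 c2 c3 c4
    unfolding Q_def by (rule real_gaussian_all_moments[OF gauss])
  have Q4i: "integrable M (\<lambda>\<omega>. Q c1 c2 c3 c4 \<omega> ^ 4)" for c1 c2 c3 c4
    using all_moments_mult[OF all_moments_mult[OF Qm Qm] all_moments_mult[OF Qm Qm], of c1 c2 c3 c4 c1 c2 c3 c4 c1 c2 c3 c4 c1 c2 c3 c4]
    by (intro int) (simp add: power4_eq_xxxx mult.assoc)
  have i2: "integrable M (\<lambda>\<omega>. X1 \<omega> * X1 \<omega>)" "integrable M (\<lambda>\<omega>. X1 \<omega> * X2 \<omega>)" "integrable M (\<lambda>\<omega>. X1 \<omega> * X3 \<omega>)"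
    "integrable M (\<lambda>\<omega>. X1 \<omega> * X4 \<omega>)" "integrable M (\<lambda>\<omega>. X2 \<omega> * X2 \<omega>)" "integrable M (\<lambda>\<omega>. X2 \<omega> * X3 \<omega>)"
    "integrable M (\<lambda>\<omega>. X2 \<omega> * X4 \<omega>)" "integrable M (\<lambda>\<omega>. X3 \<omega> * X3 \<omega>)" "integrable M (\<lambda>\<omega>. X3 \<omega> * X4 \<omega>)"
    "integrable M (\<lambda>\<omega>. X4 \<omega> * X4 \<omega>)"
    using m by (auto intro!: int all_moments_mult)
  define e where "e f = (\<integral>\<omega>. f \<omega> \<partial>M)" for f :: "'a \<Rightarrow> real"
  define S11 S12 S13 S14 S22 S23 S24 S33 S34 S44 where
    S: "S11 = e (\<lambda>\<omega>. X1 \<omega> * X1 \<omega>)" "S12 = e (\<lambda>\<omega>. X1 \<omega> * X2 \<omega>)" "S13 = e (\<lambda>\<omega>. X1 \<omega> * X3 \<omega>)"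
       "S14 = e (\<lambda>\<omega>. X1 \<omega> * X4 \<omega>)" "S22 = e (\<lambda>\<omega>. X2 \<omega> * X2 \<omega>)" "S23 = e (\<lambda>\<omega>. X2 \<omega> * X3 \<omega>)"
       "S24 = e (\<lambda>\<omega>. X2 \<omega> * X4 \<omega>)" "S33 = e (\<lambda>\<omega>. X3 \<omega> * X3 \<omega>)" "S34 = e (\<lambda>\<omega>. X3 \<omega> * X4 \<omega>)"
       "S44 = e (\<lambda>\<omega>. X4 \<omega> * X4 \<omega>)"
  have Q2: "(\<integral>\<omega>. (Q c1 c2 c3 c4 \<omega>)\<^sup>2 \<partial>M) =
    c1*c1 * S11 + c2*c2 * S22 + c3*c3 * S33 + c4*c4 * S44 + 2*c1*c2 * S12 + 2*c1*c3 * S13 + 2*c1*c4 * S14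
     + 2*c2*c3 * S23 + 2*c2*c4 * S24 + 2*c3*c4 * S34" for c1 c2 c3 c4
  proof -
    have "(Q c1 c2 c3 c4 \<omega>)\<^sup>2 =
      c1*c1 * (X1 \<omega> * X1 \<omega>) + c2*c2 * (X2 \<omega> * X2 \<omega>) + c3*c3 * (X3 \<omega> * X3 \<omega>) + c4*c4 * (X4 \<omega> * X4 \<omega>)
      + 2*c1*c2 * (X1 \<omega> * X2 \<omega>) + 2*c1*c3 * (X1 \<omega> * X3 \<omega>) + 2*c1*c4 * (X1 \<omega> * X4 \<omega>)
      + 2*c2*c3 * (X2 \<omega> * X3 \<omega>) + 2*c2*c4 * (X2 \<omega> * X4 \<omega>) + 2*c3*c4 * (X3 \<omega> * X4 \<omega>)" for \<omega>
      unfolding Q_def by (simp add: power2_eq_square algebra_simps)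
    then show ?thesis using i2 unfolding S e_def by simp
  qed
  have Q4: "(\<integral>\<omega>. (Q c1 c2 c3 c4 \<omega>) ^ 4 \<partial>M) = 3 * (\<integral>\<omega>. (Q c1 c2 c3 c4 \<omega>)\<^sup>2 \<partial>M)\<^sup>2" for c1 c2 c3 c4
    unfolding Q_def by (rule real_gaussian_fourth_moment[OF gauss]) (use i1 mean in simp)
  \<comment> \<open>With the signs of \<open>c2\<close>, \<open>c3\<close>, \<open>c4\<close> as
    weights, only monomials odd in each of X2, X3, X4 survive, and in degree four that leaves X1 X2
    X3 X4. Its coefficient in Q^4 is 4! = 24, and there are 8 sign patterns: 192 = 8 * 24.\<close>
  have pol: "192 * (X1 \<omega> * X2 \<omega> * X3 \<omega> * X4 \<omega>) =
     Q 1 1 1 1 \<omega> ^ 4 - Q 1 1 1 (-1) \<omega> ^ 4 - Q 1 1 (-1) 1 \<omega> ^ 4 + Q 1 1 (-1) (-1) \<omega> ^ 4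
     - Q 1 (-1) 1 1 \<omega> ^ 4 + Q 1 (-1) 1 (-1) \<omega> ^ 4 + Q 1 (-1) (-1) 1 \<omega> ^ 4 - Q 1 (-1) (-1) (-1) \<omega> ^ 4" for \<omega>
    unfolding Q_def by algebra
  have "192 * e (\<lambda>\<omega>. X1 \<omega> * X2 \<omega> * X3 \<omega> * X4 \<omega>) = e (\<lambda>\<omega>. 192 * (X1 \<omega> * X2 \<omega> * X3 \<omega> * X4 \<omega>))"
    unfolding e_def by simp
  also have "\<dots> = 192 * (S12 * S34 + S13 * S24 + S14 * S23)"
    unfolding pol e_def using Q4i by (simp add: Q4 Q2) (simp add: power2_eq_square algebra_simps)
  finally have main: "e (\<lambda>\<omega>. X1 \<omega> * X2 \<omega> * X3 \<omega> * X4 \<omega>) = S12 * S34 + S13 * S24 + S14 * S23"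
    by simp
  have "(\<integral>\<omega>. of_real (f \<omega>) \<partial>M) = (of_real (e f) :: complex)" for f
    by (simp add: e_def)
  with main m show ?thesis
    unfolding isserlis_def S by (simp flip: of_real_mult of_real_add)
qed

subsection \<open>Circularly symmetric Gaussian vectors\<close>

context
  fixes X :: "'a \<Rightarrow> complex^'m" and \<Sigma> :: "complex^'m^'m"
  assumes circ: "circ_gaussian M X \<Sigma>"
begin

lemma circ_gaussian_all_moments: "all_moments (\<lambda>\<omega>. X \<omega> $ i)"
proof -
  have "all_moments (\<lambda>\<omega>. of_real (Re (cdot u (X \<omega>))))" for u
    using circ by (intro real_gaussian_all_moments) (simp add: circ_gaussian_def)
  \<comment> \<open>\<open>cdot\<close> is conjugate-linear on the left, so testing against \<i>
    times a unit vector yields the imaginary part of the entry.\<close>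
  then have "all_moments (\<lambda>\<omega>. of_real (Re (cdot (axis i 1) (X \<omega>))) + \<i> * of_real (Re (cdot (axis i \<i>) (X \<omega>))))"
    by (intro all_moments_intros)
  then show ?thesis by (simp add: cdot_axis flip: complex_eq)
qed

lemma circ_gaussian_mean: "(\<integral>\<omega>. X \<omega> $ i \<partial>M) = 0"
  using circ circ_gaussian_all_moments
  by (subst integral_vec_nth[symmetric]) (auto simp: circ_gaussian_def intro: all_moments_integrable)

lemma circ_gaussian_covariance: "(\<integral>\<omega>. X \<omega> $ i * cnj (X \<omega> $ j) \<partial>M) = \<Sigma> $ i $ j"
proof -
  have m: "integrable M (\<lambda>\<omega>. outer (X \<omega>) (X \<omega>) $ i $ j)" for i j
    using circ_gaussian_all_moments unfolding outer_def
    by (auto intro!: all_moments_integrable all_moments_intros)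
  then have "(\<integral>\<omega>. outer (X \<omega>) (X \<omega>) \<partial>M) $ i $ j = (\<integral>\<omega>. outer (X \<omega>) (X \<omega>) $ i $ j \<partial>M)"
    by (simp add: integral_vec_nth integrable_vec)
  then show ?thesis using circ by (simp add: circ_gaussian_def outer_def)
qed

text \<open>A quarter turn preserves the law but multiplies the product of two entries by \<i>^2 =
  -1, so the expectation equals its own negative.\<close>

lemma circ_gaussian_pseudo_covariance: "(\<integral>\<omega>. X \<omega> $ i * X \<omega> $ j \<partial>M) = 0"
proof -
  have meas [measurable]: "X \<in> borel_measurable M" using circ by (simp add: circ_gaussian_def)
  have [measurable]: "(\<lambda>x::complex^'m. x $ i) \<in> borel_measurable borel" for i
    by (intro borel_measurable_continuous_onI continuous_intros)
  have [measurable]: "(\<lambda>x::complex^'m. \<i> *s x) \<in> borel_measurable borel"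
    unfolding vector_scalar_mult_def
    by (intro borel_measurable_continuous_onI continuous_on_vec_lambda continuous_intros)
  have "cis (pi / 2) = \<i>" by (simp add: complex_eq_iff)
  then have eq: "distr M borel (\<lambda>\<omega>. \<i> *s X \<omega>) = distr M borel X"
    using circ unfolding circ_gaussian_def by metis
  have "(\<integral>\<omega>. X \<omega> $ i * X \<omega> $ j \<partial>M) = (\<integral>x. x $ i * x $ j \<partial>distr M borel X)"
    by (subst integral_distr) auto
  also have "\<dots> = (\<integral>\<omega>. (\<i> *s X \<omega>) $ i * (\<i> *s X \<omega>) $ j \<partial>M)"
    unfolding eq[symmetric] by (subst integral_distr) auto
  also have "(\<lambda>\<omega>. (\<i> *s X \<omega>) $ i * (\<i> *s X \<omega>) $ j) = (\<lambda>\<omega>. (- 1) * (X \<omega> $ i * X \<omega> $ j))"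
    by (simp add: fun_eq_iff algebra_simps)
  finally show ?thesis by simp
qed

text \<open>Entries and their conjugates are complex combinations of jointly Gaussian real
  functionals, to which the identity extends by linearity. Of the three pairings, the one joining
  the two unconjugated entries is a product of pseudo-covariances and vanishes.\<close>

lemma circ_gaussian_isserlis:
  "(\<integral>\<omega>. X \<omega> $ j * cnj (X \<omega> $ k) * X \<omega> $ l * cnj (X \<omega> $ i) \<partial>M) =
    \<Sigma> $ j $ k * \<Sigma> $ l $ i + \<Sigma> $ j $ i * \<Sigma> $ l $ k"
proof -
  have real: "isserlis (\<lambda>\<omega>. of_real (Re (cdot u1 (X \<omega>)))) (\<lambda>\<omega>. of_real (Re (cdot u2 (X \<omega>))))
    (\<lambda>\<omega>. of_real (Re (cdot u3 (X \<omega>)))) (\<lambda>\<omega>. of_real (Re (cdot u4 (X \<omega>))))" for u1 u2 u3 u4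
  proof (rule isserlis_real_gaussian)
    fix c1 c2 c3 c4 :: real
    have "real_gaussian M (\<lambda>\<omega>. Re (cdot (c1 *\<^sub>R u1 + c2 *\<^sub>R u2 + c3 *\<^sub>R u3 + c4 *\<^sub>R u4) (X \<omega>)))"
      using circ unfolding circ_gaussian_def by blast
    then show "real_gaussian M (\<lambda>\<omega>. c1 * Re (cdot u1 (X \<omega>)) + c2 * Re (cdot u2 (X \<omega>))
      + c3 * Re (cdot u3 (X \<omega>)) + c4 * Re (cdot u4 (X \<omega>)))"
      by (simp add: cdot_add_left cdot_scaleR_left)
  next
    have "(\<integral>\<omega>. Re (cdot u (X \<omega>)) \<partial>M) = 0" for u
    proof -
      have int: "integrable M (\<lambda>\<omega>. cdot u (X \<omega>))" unfolding cdot_def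
        using circ_gaussian_all_moments by (intro all_moments_integrable all_moments_intros)
      have "(\<integral>\<omega>. cdot u (X \<omega>) \<partial>M) = 0"
        unfolding cdot_def using circ_gaussian_all_moments circ_gaussian_mean
        by (subst Bochner_Integration.integral_sum) (auto intro!: all_moments_integrable all_moments_intros)
      then show ?thesis using integral_Re[OF int] by simp
    qed
    then show "(\<integral>\<omega>. Re (cdot u1 (X \<omega>)) \<partial>M) = 0" "(\<integral>\<omega>. Re (cdot u2 (X \<omega>)) \<partial>M) = 0"
      "(\<integral>\<omega>. Re (cdot u3 (X \<omega>)) \<partial>M) = 0" "(\<integral>\<omega>. Re (cdot u4 (X \<omega>)) \<partial>M) = 0" by auto
  qed
  define r where "r u \<omega> = complex_of_real (Re (cdot u (X \<omega>)))" for u \<omega>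
  define L where "L u c v \<omega> = r u \<omega> + c * r v \<omega>" for u c v \<omega>
  \<comment> \<open>One step replaces the first argument by a complex combination and rotates it to
    the end; after four steps all arguments are replaced and the original order is restored.\<close>
  have step: "isserlis f2 f3 f4 (L u c v)" if "\<And>u. isserlis (r u) f2 f3 f4" for f2 f3 f4 u c v
    unfolding L_def[abs_def] by (rule isserlis_rotate[OF isserlis_linear]) (rule that)+
  have L0: "isserlis (r u1) (r u2) (r u3) (r u4)" for u1 u2 u3 u4
    unfolding r_def[abs_def] by (rule real)
  have L1: "isserlis (r u2) (r u3) (r u4) (L u1 c1 v1)" for u1 c1 v1 u2 u3 u4
    by (rule step) (rule L0)
  have L2: "isserlis (r u3) (r u4) (L u1 c1 v1) (L u2 c2 v2)" for u1 c1 v1 u2 c2 v2 u3 u4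
    by (rule step) (rule L1)
  have L3: "isserlis (r u4) (L u1 c1 v1) (L u2 c2 v2) (L u3 c3 v3)" for u1 c1 v1 u2 c2 v2 u3 c3 v3 u4
    by (rule step) (rule L2)
  have L: "isserlis (L u1 c1 v1) (L u2 c2 v2) (L u3 c3 v3) (L u4 c4 v4)" for u1 c1 v1 u2 c2 v2 u3 c3 v3 u4 c4 v4
    by (rule step) (rule L3)
  \<comment> \<open>The two real functionals are the real and imaginary parts of entry
    \<open>n\<close>; the coefficient \<i> or -\<i> assembles the entry or its conjugate.\<close>
  have "L (axis n 1) \<i> (axis n \<i>) = (\<lambda>\<omega>. X \<omega> $ n)"
    "L (axis n 1) (- \<i>) (axis n \<i>) = (\<lambda>\<omega>. cnj (X \<omega> $ n))" for n
    by (auto simp: L_def r_def cdot_axis fun_eq_iff complex_eq_iff)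
  with L[of "axis j 1" \<i> "axis j \<i>" "axis k 1" "- \<i>" "axis k \<i>" "axis l 1" \<i> "axis l \<i>" "axis i 1" "- \<i>" "axis i \<i>"]
  have "isserlis (\<lambda>\<omega>. X \<omega> $ j) (\<lambda>\<omega>. cnj (X \<omega> $ k)) (\<lambda>\<omega>. X \<omega> $ l) (\<lambda>\<omega>. cnj (X \<omega> $ i))"
    by simp
  moreover have "(\<integral>\<omega>. cnj (X \<omega> $ k) * X \<omega> $ l \<partial>M) = \<Sigma> $ l $ k" for k l
    using circ_gaussian_covariance[of l k] by (simp only: mult.commute[of "cnj (X _ $ k)"])
  ultimately show ?thesis
    unfolding isserlis_def by (simp add: circ_gaussian_covariance circ_gaussian_pseudo_covariance)
qed

end

subsection \<open>Independent \<open>\<sigma>\<close>-algebras\<close>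

text \<open>A sub-sigma-algebra is carried by a measure of which only the space and the measurable
  sets matter. Dependence on certain sources alone then reads
  \<open>f \<in> borel_measurable N\<close> and is inherited by every measurable expression in
  them.\<close>

definition indep_algebras :: "'a measure \<Rightarrow> 'a measure \<Rightarrow> bool"
  where "indep_algebras N N' \<longleftrightarrow> space N = space M \<and> space N' = space M \<and> indep_set (sets N) (sets N')"

lemma indep_algebras_integral_mult:
  fixes f h :: "'a \<Rightarrow> complex"
  assumes ind: "indep_algebras N N'"
    and f: "f \<in> borel_measurable N" and h: "h \<in> borel_measurable N'"
    and m: "all_moments f" "all_moments h"
  shows "(\<integral>\<omega>. f \<omega> * h \<omega> \<partial>M) = (\<integral>\<omega>. f \<omega> \<partial>M) * (\<integral>\<omega>. h \<omega> \<partial>M)"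
proof (rule indep_var_lebesgue_integral)
  have "sigma_sets (space M) {f -` A \<inter> space M |A. A \<in> sets borel} \<subseteq> sets N"
    using ind measurable_sets[OF f] sets.top[of N]
    by (intro sets.sigma_sets_subset') (auto simp: indep_algebras_def)
  moreover have "sigma_sets (space M) {h -` A \<inter> space M |A. A \<in> sets borel} \<subseteq> sets N'"
    using ind measurable_sets[OF h] sets.top[of N']
    by (intro sets.sigma_sets_subset') (auto simp: indep_algebras_def)
  moreover have "indep_sets (case_bool (sets N) (sets N')) UNIV"
    using ind by (simp add: indep_algebras_def indep_set_def)
  ultimately have "indep_set (sigma_sets (space M) {f -` A \<inter> space M |A. A \<in> sets borel})
      (sigma_sets (space M) {h -` A \<inter> space M |A. A \<in> sets borel})"
    unfolding indep_set_def
    by - (erule indep_sets_mono, simp, case_tac i, simp_all)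
  then show "indep_var borel f borel h"
    using m by (simp add: indep_var_eq all_moments_measurable)
qed (use m in \<open>auto intro: all_moments_integrable\<close>)

lemma expectation_bilinear:
  assumes "\<And>i. all_moments (\<lambda>\<omega>. X \<omega> $ i)" and "\<And>i. all_moments (\<lambda>\<omega>. Y \<omega> $ i)"
    and "\<And>i j. (\<integral>\<omega>. X \<omega> $ i * cnj (Y \<omega> $ j) \<partial>M) = S $ i $ j"
  shows "(\<integral>\<omega>. cdot (Y \<omega>) (B *v X \<omega>) \<partial>M) = trace (B ** S)"
proof -
  have "cdot (Y \<omega>) (B *v X \<omega>) = (\<Sum>i\<in>UNIV. \<Sum>j\<in>UNIV. B $ i $ j * (X \<omega> $ j * cnj (Y \<omega> $ i)))" for \<omega>
    by (simp add: cdot_def matrix_vector_mult_def sum_distrib_left mult_ac)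
  moreover have "integrable M (\<lambda>\<omega>. X \<omega> $ j * cnj (Y \<omega> $ i))" for i j
    by (intro all_moments_integrable all_moments_intros assms)
  ultimately show ?thesis by (simp add: trace_mult assms(3))
qed

lemma all_moments_cdot:
  assumes "\<And>i. all_moments (\<lambda>\<omega>. X \<omega> $ i)" and "\<And>i. all_moments (\<lambda>\<omega>. Y \<omega> $ i)"
  shows "all_moments (\<lambda>\<omega>. cdot (Y \<omega>) (X \<omega>))"
  unfolding cdot_def by (intro all_moments_intros assms)

lemma all_moments_matrix_vector_mult:
  assumes "\<And>i. all_moments (\<lambda>\<omega>. X \<omega> $ i)"
  shows "all_moments (\<lambda>\<omega>. (B *v X \<omega>) $ i)"
  unfolding matrix_vector_mult_def by (simp, intro all_moments_intros assms)

lemma expectation_quadratic: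
  assumes "\<And>i. all_moments (\<lambda>\<omega>. X \<omega> $ i)" and "\<And>i. all_moments (\<lambda>\<omega>. Y \<omega> $ i)"
  shows "(\<integral>\<omega>. cdot (Y \<omega>) (B *v X \<omega>) * cnj (cdot (Y \<omega>) (B *v X \<omega>)) \<partial>M) =
    (\<Sum>i\<in>UNIV. \<Sum>l\<in>UNIV. \<Sum>k\<in>UNIV. \<Sum>j\<in>UNIV. B $ i $ j * cnj (B $ l $ k) *
      (\<integral>\<omega>. X \<omega> $ j * cnj (X \<omega> $ k) * (Y \<omega> $ l * cnj (Y \<omega> $ i)) \<partial>M))"
proof -
  have "integrable M (\<lambda>\<omega>. X \<omega> $ j * cnj (X \<omega> $ k) * (Y \<omega> $ l * cnj (Y \<omega> $ i)))" for i j k l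
    by (intro all_moments_integrable all_moments_intros assms)
  then show ?thesis unfolding cmod2_cdot_mult by simp
qed

text \<open>Independence separates the pair of entries of \<open>X\<close> from the pair of entries
  of \<open>Y\<close>, so second moments suffice. This covers both the noise part of an observation
  and an observation made with a different pilot.\<close>

lemma expectation_quadratic_indep:
  assumes ind: "indep_algebras N N'"
    and X: "\<And>i. (\<lambda>\<omega>. X \<omega> $ i) \<in> borel_measurable N" "\<And>i. all_moments (\<lambda>\<omega>. X \<omega> $ i)"
    and Y: "\<And>i. (\<lambda>\<omega>. Y \<omega> $ i) \<in> borel_measurable N'" "\<And>i. all_moments (\<lambda>\<omega>. Y \<omega> $ i)"
    and SX: "\<And>i j. (\<integral>\<omega>. X \<omega> $ i * cnj (X \<omega> $ j) \<partial>M) = SX $ i $ j"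
    and SY: "\<And>i j. (\<integral>\<omega>. Y \<omega> $ i * cnj (Y \<omega> $ j) \<partial>M) = SY $ i $ j"
  shows "(\<integral>\<omega>. cdot (Y \<omega>) (B *v X \<omega>) * cnj (cdot (Y \<omega>) (B *v X \<omega>)) \<partial>M) = trace (B ** SX ** herm B ** SY)"
proof -
  note [measurable] = X(1) Y(1)
  have "(\<integral>\<omega>. X \<omega> $ j * cnj (X \<omega> $ k) * (Y \<omega> $ l * cnj (Y \<omega> $ i)) \<partial>M) = SX $ j $ k * SY $ l $ i" for i j k l
    unfolding SX[symmetric] SY[symmetric]
  proof (rule indep_algebras_integral_mult[OF ind])
    show "all_moments (\<lambda>\<omega>. X \<omega> $ j * cnj (X \<omega> $ k))" "all_moments (\<lambda>\<omega>. Y \<omega> $ l * cnj (Y \<omega> $ i))"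
      by (intro all_moments_intros X(2) Y(2))+
  qed measurable
  then show ?thesis
    unfolding expectation_quadratic[OF X(2) Y(2)] trace_mult4
    by (simp add: herm_def mult_ac)
qed

subsection \<open>Rician vectors\<close>

context
  fixes p :: "'a \<Rightarrow> complex" and v :: "complex^'m" and G X :: "'a \<Rightarrow> complex^'m"
    and \<Sigma> :: "complex^'m^'m" and N N' :: "'a measure"
  assumes p: "p \<in> borel_measurable N" "\<And>\<omega>. cmod (p \<omega>) = 1" "p \<in> borel_measurable M" "(\<integral>\<omega>. p \<omega> \<partial>M) = 0"
    and G: "circ_gaussian M G \<Sigma>" "\<And>i. (\<lambda>\<omega>. G \<omega> $ i) \<in> borel_measurable N'"
    and ind: "indep_algebras N N'"
    and X: "\<And>\<omega>. X \<omega> = p \<omega> *s v + G \<omega>"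
begin

lemma phase_all_moments: "all_moments p"
  using p(2,3) by (intro all_moments_bounded[where B=1]) auto

lemma rician_all_moments: "all_moments (\<lambda>\<omega>. X \<omega> $ i)"
  unfolding X by (simp, intro all_moments_intros phase_all_moments circ_gaussian_all_moments[OF G(1)])

lemma rician_mean: "(\<integral>\<omega>. X \<omega> $ i \<partial>M) = 0"
proof -
  have "integrable M p" "integrable M (\<lambda>\<omega>. G \<omega> $ i)"
    by (intro all_moments_integrable phase_all_moments circ_gaussian_all_moments[OF G(1)])+
  then show ?thesis unfolding X by (simp add: p(4) circ_gaussian_mean[OF G(1)])
qed

text \<open>A single phase factor annihilates any function of the scattered part; this disposes of
  all terms of odd degree in \<open>G\<close> without computing their moments.\<close>

lemma phase_mult_mean:
  assumes "h \<in> borel_measurable N'" "all_moments h"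
  shows "(\<integral>\<omega>. p \<omega> * h \<omega> \<partial>M) = 0"
  using indep_algebras_integral_mult[OF ind p(1) assms(1) phase_all_moments assms(2)] p(4) by simp

lemma cnj_phase_mult_mean:
  assumes [measurable]: "h \<in> borel_measurable N'" and "all_moments h"
  shows "(\<integral>\<omega>. cnj (p \<omega>) * h \<omega> \<partial>M) = 0"
  using phase_mult_mean[of "\<lambda>\<omega>. cnj (h \<omega>)"] assms Bochner_Integration.integral_cnj[of M "\<lambda>\<omega>. cnj (p \<omega>) * h \<omega>"]
  by (simp add: all_moments_cnj)

lemma phase_mult_cnj: "p \<omega> * cnj (p \<omega>) = 1"
  using p(2)[of \<omega>] by (simp add: complex_norm_square[symmetric])

lemma rician_covariance: "(\<integral>\<omega>. X \<omega> $ i * cnj (X \<omega> $ j) \<partial>M) = (\<Sigma> + outer v v) $ i $ j"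
proof -
  note [measurable] = G(2)
  note mom = all_moments_intros phase_all_moments circ_gaussian_all_moments[OF G(1)]
  have eq: "X \<omega> $ i * cnj (X \<omega> $ j) = v $ i * cnj (v $ j) + p \<omega> * (v $ i * cnj (G \<omega> $ j))
    + cnj (p \<omega>) * (cnj (v $ j) * G \<omega> $ i) + G \<omega> $ i * cnj (G \<omega> $ j)" for \<omega>
    using phase_mult_cnj[of \<omega>] by (simp add: X) algebra
  have "integrable M (\<lambda>\<omega>. p \<omega> * (v $ i * cnj (G \<omega> $ j)))" "integrable M (\<lambda>\<omega>. cnj (p \<omega>) * (cnj (v $ j) * G \<omega> $ i))"
    "integrable M (\<lambda>\<omega>. G \<omega> $ i * cnj (G \<omega> $ j))"
    by (intro all_moments_integrable mom)+
  moreover have "(\<integral>\<omega>. p \<omega> * (v $ i * cnj (G \<omega> $ j)) \<partial>M) = 0"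
    by (rule phase_mult_mean) (measurable, intro mom)
  moreover have "(\<integral>\<omega>. cnj (p \<omega>) * (cnj (v $ j) * G \<omega> $ i) \<partial>M) = 0"
    by (rule cnj_phase_mult_mean) (measurable, intro mom)
  ultimately show ?thesis
    unfolding eq by (simp add: prob_space circ_gaussian_covariance[OF G(1)] outer_def)
qed

text \<open>Compared with a Gaussian vector of the same covariance, the unimodular factor only
  contributes the last term.\<close>

lemma rician_fourth_moment:
  fixes R :: "complex^'m^'m"
  defines "R \<equiv> \<Sigma> + outer v v"
  shows "(\<integral>\<omega>. X \<omega> $ j * cnj (X \<omega> $ k) * (X \<omega> $ l * cnj (X \<omega> $ i)) \<partial>M) =
    R $ j $ k * R $ l $ i + R $ j $ i * R $ l $ k - v $ j * cnj (v $ k) * (v $ l * cnj (v $ i))"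
proof -
  note [measurable] = G(2)
  note mom = all_moments_intros phase_all_moments circ_gaussian_all_moments[OF G(1)]
  \<comment> \<open>The expanded product is sorted by its phase factor: \<open>F0\<close> collects
    the terms quadratic in \<open>G\<close> without phase, and \<open>F1\<close>, \<open>F2\<close>,
    \<open>F3\<close>, \<open>F4\<close> are the cofactors of p, conj(p), p^2, conj(p)^2.\<close>
  define F0 F1 F2 F3 F4 where
    "F0 \<omega> = v $ j * cnj (v $ k) * (G \<omega> $ l * cnj (G \<omega> $ i)) + v $ j * cnj (v $ i) * (G \<omega> $ l * cnj (G \<omega> $ k))
      + v $ l * cnj (v $ k) * (G \<omega> $ j * cnj (G \<omega> $ i)) + v $ l * cnj (v $ i) * (G \<omega> $ j * cnj (G \<omega> $ k))"
  and "F1 \<omega> = v $ j * cnj (v $ k) * v $ l * cnj (G \<omega> $ i) + v $ j * v $ l * cnj (v $ i) * cnj (G \<omega> $ k)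
      + v $ j * cnj (G \<omega> $ k) * G \<omega> $ l * cnj (G \<omega> $ i) + v $ l * G \<omega> $ j * cnj (G \<omega> $ k) * cnj (G \<omega> $ i)"
  and "F2 \<omega> = cnj (v $ k) * v $ l * cnj (v $ i) * G \<omega> $ j + v $ j * cnj (v $ k) * cnj (v $ i) * G \<omega> $ l
      + cnj (v $ k) * G \<omega> $ j * G \<omega> $ l * cnj (G \<omega> $ i) + cnj (v $ i) * G \<omega> $ j * cnj (G \<omega> $ k) * G \<omega> $ l"
  and "F3 \<omega> = v $ j * v $ l * cnj (G \<omega> $ k * G \<omega> $ i)"
  and "F4 \<omega> = cnj (v $ k) * cnj (v $ i) * (G \<omega> $ j * G \<omega> $ l)" for \<omega>
  note F = F0_def F1_def F2_def F3_def F4_def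
  have mF: "all_moments F0" "all_moments F1" "all_moments F2" "all_moments F3" "all_moments F4"
    unfolding F[abs_def] by (intro mom)+
  have mN: "F1 \<in> borel_measurable N'" "F2 \<in> borel_measurable N'" "F3 \<in> borel_measurable N'" "F4 \<in> borel_measurable N'"
    unfolding F[abs_def] by measurable
  have iG: "integrable M (\<lambda>\<omega>. G \<omega> $ i * cnj (G \<omega> $ j))" "integrable M (\<lambda>\<omega>. G \<omega> $ i * G \<omega> $ j)" for i j
    by (intro all_moments_integrable mom)+
  have E0: "(\<integral>\<omega>. F0 \<omega> \<partial>M) = v $ j * cnj (v $ k) * \<Sigma> $ l $ i + v $ j * cnj (v $ i) * \<Sigma> $ l $ k
      + v $ l * cnj (v $ k) * \<Sigma> $ j $ i + v $ l * cnj (v $ i) * \<Sigma> $ j $ k"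
    unfolding F using iG by (simp add: circ_gaussian_covariance[OF G(1)])
  \<comment> \<open>Nothing is assumed about the mean of p^2. Its terms vanish because their
    Gaussian cofactors are pseudo-covariances.\<close>
  have E34: "(\<integral>\<omega>. F3 \<omega> \<partial>M) = 0" "(\<integral>\<omega>. F4 \<omega> \<partial>M) = 0"
    unfolding F by (simp_all only: integral_mult_right_zero Bochner_Integration.integral_cnj circ_gaussian_pseudo_covariance[OF G(1)]) simp_all
  have E: "(\<integral>\<omega>. p \<omega> * F1 \<omega> \<partial>M) = 0" "(\<integral>\<omega>. cnj (p \<omega>) * F2 \<omega> \<partial>M) = 0"
    by (intro phase_mult_mean cnj_phase_mult_mean mN mF)+
  have p2: "all_moments (\<lambda>\<omega>. p \<omega> * p \<omega>)" "(\<lambda>\<omega>. p \<omega> * p \<omega>) \<in> borel_measurable N"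
    using p(1) by (auto intro: mom)
  have E': "(\<integral>\<omega>. p \<omega> * p \<omega> * F3 \<omega> \<partial>M) = 0" "(\<integral>\<omega>. cnj (p \<omega> * p \<omega>) * F4 \<omega> \<partial>M) = 0"
    using indep_algebras_integral_mult[OF ind p2(2) mN(3) p2(1) mF(4)]
      indep_algebras_integral_mult[OF ind measurable_compose[OF p2(2) borel_measurable_cnj] mN(4) all_moments_cnj[OF p2(1)] mF(5)]
    by (simp_all add: E34)
  have eq: "X \<omega> $ j * cnj (X \<omega> $ k) * (X \<omega> $ l * cnj (X \<omega> $ i)) =
    v $ j * cnj (v $ k) * (v $ l * cnj (v $ i)) + F0 \<omega> + G \<omega> $ j * cnj (G \<omega> $ k) * G \<omega> $ l * cnj (G \<omega> $ i)
    + p \<omega> * F1 \<omega> + cnj (p \<omega>) * F2 \<omega> + p \<omega> * p \<omega> * F3 \<omega> + cnj (p \<omega> * p \<omega>) * F4 \<omega>" for \<omega>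
    using phase_mult_cnj[of \<omega>] unfolding F X by simp algebra
  have "integrable M F0" "integrable M (\<lambda>\<omega>. G \<omega> $ j * cnj (G \<omega> $ k) * G \<omega> $ l * cnj (G \<omega> $ i))"
    "integrable M (\<lambda>\<omega>. p \<omega> * F1 \<omega>)" "integrable M (\<lambda>\<omega>. cnj (p \<omega>) * F2 \<omega>)"
    "integrable M (\<lambda>\<omega>. p \<omega> * p \<omega> * F3 \<omega>)" "integrable M (\<lambda>\<omega>. cnj (p \<omega> * p \<omega>) * F4 \<omega>)"
    by (intro all_moments_integrable mom mF)+
  then have "(\<integral>\<omega>. X \<omega> $ j * cnj (X \<omega> $ k) * (X \<omega> $ l * cnj (X \<omega> $ i)) \<partial>M) =
     v $ j * cnj (v $ k) * (v $ l * cnj (v $ i)) + (\<integral>\<omega>. F0 \<omega> \<partial>M) + (\<Sigma> $ j $ k * \<Sigma> $ l $ i + \<Sigma> $ j $ i * \<Sigma> $ l $ k)"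
    unfolding eq by (simp add: E E'[simplified] prob_space circ_gaussian_isserlis[OF G(1)])
  \<comment> \<open>Both products of entries of \<open>R\<close> contain the pure line-of-sight
    term, whereas the true moment contains it once; hence the subtraction.\<close>
  then show ?thesis
    unfolding E0 R_def by (simp add: outer_def algebra_simps)
qed

lemma herm_covariance: "herm \<Sigma> = \<Sigma>"
proof -
  have "cnj (\<Sigma> $ j $ i) = \<Sigma> $ i $ j" for i j
    unfolding circ_gaussian_covariance[OF G(1), symmetric] Bochner_Integration.integral_cnj[symmetric] by (simp add: mult.commute)
  then show ?thesis by (simp add: herm_def vec_eq_iff)
qed

text \<open>The three terms of the fourth moment are summed separately: the pairing (jk)(li) gives
  the four-matrix trace, (ji)(lk) gives the squared trace, and the correction gives the squared form
  in \<open>v\<close>.\<close>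

lemma rician_quadratic:
  fixes R :: "complex^'m^'m"
  defines "R \<equiv> \<Sigma> + outer v v"
  shows "(\<integral>\<omega>. cdot (X \<omega>) (B *v X \<omega>) * cnj (cdot (X \<omega>) (B *v X \<omega>)) \<partial>M) =
    trace (B ** R ** herm B ** R) + trace (B ** R) * cnj (trace (B ** R))
    - cdot v (B *v v) * cnj (cdot v (B *v v))"
proof -
  have R: "cnj (R $ i $ j) = R $ j $ i" for i j
    using herm_covariance by (simp add: R_def outer_def herm_def vec_eq_iff mult.commute)
  have "trace (B ** R) * cnj (trace (B ** R)) =
    (\<Sum>i\<in>UNIV. \<Sum>l\<in>UNIV. \<Sum>k\<in>UNIV. \<Sum>j\<in>UNIV. B $ i $ j * cnj (B $ l $ k) * (R $ j $ i * R $ l $ k))"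
  proof -
    have "trace (B ** R) * cnj (trace (B ** R)) = (\<Sum>i\<in>UNIV. \<Sum>l\<in>UNIV.
      (\<Sum>j\<in>UNIV. B $ i $ j * R $ j $ i) * (\<Sum>k\<in>UNIV. cnj (B $ l $ k) * R $ l $ k))"
      by (simp add: trace_mult sum_product R)
    then show ?thesis by (simp add: sum_distrib_left sum_distrib_right mult_ac)
  qed
  moreover have "trace (B ** R ** herm B ** R) =
    (\<Sum>i\<in>UNIV. \<Sum>l\<in>UNIV. \<Sum>k\<in>UNIV. \<Sum>j\<in>UNIV. B $ i $ j * cnj (B $ l $ k) * (R $ j $ k * R $ l $ i))"
    by (simp add: trace_mult4 herm_def mult_ac)
  moreover have "x * y * (a + b - c) = x * y * a + x * y * b - x * y * c" for x y a b c :: complex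
    by (simp add: algebra_simps)
  ultimately show ?thesis
    unfolding expectation_quadratic[OF rician_all_moments rician_all_moments] rician_fourth_moment
      R_def[symmetric]
    unfolding cmod2_cdot_mult
    by (simp only: sum_subtractf sum.distrib)
qed

end

subsection \<open>Observation of a Rician vector in independent noise\<close>

context
  fixes X Y Z :: "'a \<Rightarrow> complex^'m" and s :: real and N N' :: "'a measure" and SX SZ :: "complex^'m^'m"
  assumes ind: "indep_algebras N N'"
    and X: "\<And>i. (\<lambda>\<omega>. X \<omega> $ i) \<in> borel_measurable N" "\<And>i. all_moments (\<lambda>\<omega>. X \<omega> $ i)"
    and Y: "\<And>i. (\<lambda>\<omega>. Y \<omega> $ i) \<in> borel_measurable N'" "\<And>i. all_moments (\<lambda>\<omega>. Y \<omega> $ i)"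
    and Z: "\<And>\<omega>. Z \<omega> = s *\<^sub>R X \<omega> + Y \<omega>"
    and mean: "\<And>i. (\<integral>\<omega>. Y \<omega> $ i \<partial>M) = 0"
    and SX: "\<And>i j. (\<integral>\<omega>. X \<omega> $ i * cnj (X \<omega> $ j) \<partial>M) = SX $ i $ j"
    and SZ: "\<And>i j. (\<integral>\<omega>. Z \<omega> $ i * cnj (Z \<omega> $ j) \<partial>M) = SZ $ i $ j"
begin

lemma mult_noise_mean:
  assumes "f \<in> borel_measurable N" "all_moments f"
  shows "(\<integral>\<omega>. f \<omega> * Y \<omega> $ i \<partial>M) = 0"
  using indep_algebras_integral_mult[OF ind assms(1) Y(1) assms(2) Y(2)] mean by simp

lemma mult_cnj_noise_mean:
  assumes [measurable]: "f \<in> borel_measurable N" and "all_moments f"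
  shows "(\<integral>\<omega>. f \<omega> * cnj (Y \<omega> $ i) \<partial>M) = 0"
  using mult_noise_mean[of "\<lambda>\<omega>. cnj (f \<omega>)" i] assms Bochner_Integration.integral_cnj[of M "\<lambda>\<omega>. f \<omega> * cnj (Y \<omega> $ i)"]
  by (simp add: all_moments_cnj)

text \<open>The cross terms of Z Z^H have mean zero, so the covariance of \<open>Y\<close> follows
  by subtraction and need not be assembled from the interferers and the thermal noise.\<close>

lemma noise_covariance:
  "(\<integral>\<omega>. Y \<omega> $ i * cnj (Y \<omega> $ j) \<partial>M) = (SZ - (of_real (s\<^sup>2) :: real) *\<^sub>R SX) $ i $ j"
proof -
  note mom = all_moments_intros X(2) Y(2)
  have "integrable M (\<lambda>\<omega>. X \<omega> $ i * cnj (X \<omega> $ j))" "integrable M (\<lambda>\<omega>. X \<omega> $ i * cnj (Y \<omega> $ j))"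
    "integrable M (\<lambda>\<omega>. cnj (X \<omega> $ j) * Y \<omega> $ i)" "integrable M (\<lambda>\<omega>. Y \<omega> $ i * cnj (Y \<omega> $ j))"
    by (intro all_moments_integrable mom)+
  moreover have "Z \<omega> $ i * cnj (Z \<omega> $ j) = of_real (s * s) * (X \<omega> $ i * cnj (X \<omega> $ j)) + of_real s * (X \<omega> $ i * cnj (Y \<omega> $ j))
    + of_real s * (cnj (X \<omega> $ j) * Y \<omega> $ i) + Y \<omega> $ i * cnj (Y \<omega> $ j)" for \<omega>
    by (simp add: Z scaleR_conv_of_real[where 'a=complex] algebra_simps)
  moreover have "(\<integral>\<omega>. X \<omega> $ i * cnj (Y \<omega> $ j) \<partial>M) = 0"
    by (intro mult_cnj_noise_mean X)
  moreover have "(\<integral>\<omega>. cnj (X \<omega> $ j) * Y \<omega> $ i \<partial>M) = 0"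
    using X(1)[measurable] by (intro mult_noise_mean all_moments_cnj X) measurable
  ultimately have "SZ $ i $ j = of_real (s * s) * SX $ i $ j + (\<integral>\<omega>. Y \<omega> $ i * cnj (Y \<omega> $ j) \<partial>M)"
    unfolding SZ[symmetric] SX[symmetric] by simp
  then show ?thesis by (simp add: scaleR_conv_of_real[where 'a=complex] power2_eq_square)
qed

lemma observation_all_moments: "all_moments (\<lambda>\<omega>. Z \<omega> $ i)"
  unfolding Z scaleR_conv_of_real[where 'a=complex] by (simp add: scaleR_conv_of_real[where 'a=complex], intro all_moments_intros X Y)

lemma observation_bilinear: "(\<integral>\<omega>. cdot (Z \<omega>) (B *v X \<omega>) \<partial>M) = of_real s * trace (B ** SX)"
proof -
  note mom = all_moments_intros X(2) Y(2)
  have "(\<integral>\<omega>. X \<omega> $ i * cnj (Z \<omega> $ j) \<partial>M) = (s *\<^sub>R SX) $ i $ j" for i j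
  proof -
    have "integrable M (\<lambda>\<omega>. X \<omega> $ i * cnj (X \<omega> $ j))" "integrable M (\<lambda>\<omega>. X \<omega> $ i * cnj (Y \<omega> $ j))"
      by (intro all_moments_integrable mom)+
    moreover have "X \<omega> $ i * cnj (Z \<omega> $ j) = of_real s * (X \<omega> $ i * cnj (X \<omega> $ j)) + X \<omega> $ i * cnj (Y \<omega> $ j)" for \<omega>
      by (simp add: Z scaleR_conv_of_real[where 'a=complex] algebra_simps)
    moreover have "(\<integral>\<omega>. X \<omega> $ i * cnj (Y \<omega> $ j) \<partial>M) = 0"
      by (intro mult_cnj_noise_mean X)
    ultimately show ?thesis by (simp add: SX scaleR_conv_of_real[where 'a=complex])
  qed
  then have "(\<integral>\<omega>. cdot (Z \<omega>) (B *v X \<omega>) \<partial>M) = trace (B ** (s *\<^sub>R SX))"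
    by (intro expectation_bilinear X observation_all_moments)
  then show ?thesis
    by (simp add: trace_mult sum_distrib_left scaleR_conv_of_real[where 'a=complex] mult_ac)
qed

text \<open>The form splits as s q + w with q = X^H B X and w = Y^H B X. The mixed product of q and
  conj(w) is linear in the entries of \<open>Y\<close> with coefficients depending on
  \<open>X\<close>, hence has mean zero. The negative trace stems from
  \<open>noise_covariance\<close> and is there to meet its counterpart in
  \<open>rician_quadratic\<close>.\<close>

lemma observation_quadratic:
  "(\<integral>\<omega>. cdot (Z \<omega>) (B *v X \<omega>) * cnj (cdot (Z \<omega>) (B *v X \<omega>)) \<partial>M) =
     of_real (s\<^sup>2) * (\<integral>\<omega>. cdot (X \<omega>) (B *v X \<omega>) * cnj (cdot (X \<omega>) (B *v X \<omega>)) \<partial>M)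
     + trace (B ** SX ** herm B ** SZ) - of_real (s\<^sup>2) * trace (B ** SX ** herm B ** SX)"
proof -
  note mom = all_moments_intros X(2) Y(2)
  note [measurable] = X(1)
  define q where "q \<omega> = cdot (X \<omega>) (B *v X \<omega>)" for \<omega>
  define w where "w \<omega> = cdot (Y \<omega>) (B *v X \<omega>)" for \<omega>
  have q: "all_moments q" and w: "all_moments w"
    unfolding q_def[abs_def] w_def[abs_def]
    by (intro all_moments_cdot all_moments_matrix_vector_mult X Y)+
  have BX [measurable]: "(\<lambda>\<omega>. (B *v X \<omega>) $ i) \<in> borel_measurable N" for i
    unfolding matrix_vector_mult_def by simp
  have qN [measurable]: "q \<in> borel_measurable N"
    unfolding q_def[abs_def] cdot_def by measurable
  have wq: "(\<integral>\<omega>. q \<omega> * cnj (w \<omega>) \<partial>M) = 0"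
  proof -
    have eq: "q \<omega> * cnj (w \<omega>) = (\<Sum>i\<in>UNIV. q \<omega> * cnj ((B *v X \<omega>) $ i) * Y \<omega> $ i)" for \<omega>
      by (simp add: w_def cdot_def sum_distrib_left mult_ac)
    have "(\<integral>\<omega>. q \<omega> * cnj ((B *v X \<omega>) $ i) * Y \<omega> $ i \<partial>M) = 0" for i
      by (rule mult_noise_mean) (measurable, intro mom q all_moments_matrix_vector_mult)
    moreover have "integrable M (\<lambda>\<omega>. q \<omega> * cnj ((B *v X \<omega>) $ i) * Y \<omega> $ i)" for i
      by (intro all_moments_integrable mom q all_moments_matrix_vector_mult)
    ultimately show ?thesis unfolding eq by simp
  qed
  have qw: "(\<integral>\<omega>. cnj (q \<omega>) * w \<omega> \<partial>M) = 0"
    using Bochner_Integration.integral_cnj[of M "\<lambda>\<omega>. q \<omega> * cnj (w \<omega>)"] wq by simp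
  have eq: "cdot (Z \<omega>) (B *v X \<omega>) * cnj (cdot (Z \<omega>) (B *v X \<omega>)) =
    of_real (s\<^sup>2) * (q \<omega> * cnj (q \<omega>)) + of_real s * (q \<omega> * cnj (w \<omega>)) + of_real s * (cnj (q \<omega>) * w \<omega>) + w \<omega> * cnj (w \<omega>)" for \<omega>
    by (simp add: Z cdot_add_left cdot_scaleR_left power2_eq_square algebra_simps flip: q_def w_def)
  have "integrable M (\<lambda>\<omega>. q \<omega> * cnj (q \<omega>))" "integrable M (\<lambda>\<omega>. q \<omega> * cnj (w \<omega>))"
    "integrable M (\<lambda>\<omega>. cnj (q \<omega>) * w \<omega>)" "integrable M (\<lambda>\<omega>. w \<omega> * cnj (w \<omega>))"
    by (intro all_moments_integrable all_moments_intros q w)+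
  then have "(\<integral>\<omega>. cdot (Z \<omega>) (B *v X \<omega>) * cnj (cdot (Z \<omega>) (B *v X \<omega>)) \<partial>M) =
     of_real (s\<^sup>2) * (\<integral>\<omega>. q \<omega> * cnj (q \<omega>) \<partial>M) + (\<integral>\<omega>. w \<omega> * cnj (w \<omega>) \<partial>M)"
    unfolding eq by (simp add: wq qw)
  also have "(\<integral>\<omega>. w \<omega> * cnj (w \<omega>) \<partial>M) = trace (B ** SX ** herm B ** (SZ - s\<^sup>2 *\<^sub>R SX))"
    unfolding w_def using noise_covariance by (intro expectation_quadratic_indep[OF ind X Y SX]) simp
  also have "\<dots> = trace (B ** SX ** herm B ** SZ) - of_real (s\<^sup>2) * trace (B ** SX ** herm B ** SX)"
    by (simp add: trace_mult[of "B ** SX ** herm B"] sum_subtractf sum_distrib_left right_diff_distrib scaleR_conv_of_real[where 'a=complex] mult_ac)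
  finally show ?thesis unfolding q_def by simp
qed

end

lemma uniform_phase_mean:
  assumes "distributed M lborel \<theta> (\<lambda>x. ennreal (indicator {0..<2 * pi} x / (2 * pi)))"
  shows "(\<integral>\<omega>. cis (\<theta> \<omega>) \<partial>M) = 0"
proof -
  have [measurable]: "\<theta> \<in> borel_measurable M"
    using distributed_measurable[OF assms] by simp
  \<comment> \<open>An expectation over the uniform phase is the increment of a primitive over one
    period, which is zero for the primitives sin and -cos used below.\<close>
  have eq: "(\<integral>\<omega>. f (\<theta> \<omega>) \<partial>M) = (F (2 * pi) - F 0) / (2 * pi)"
    if F: "\<And>x. (F has_real_derivative f x) (at x)" and f: "continuous_on UNIV f" for f F
  proof -
    have [measurable]: "f \<in> borel_measurable borel" by (rule borel_measurable_continuous_onI[OF f])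
    have "(\<integral>\<omega>. f (\<theta> \<omega>) \<partial>M) = (\<integral>x. indicator {0..<2 * pi} x / (2 * pi) * f x \<partial>lborel)"
      by (rule distributed_integral[OF assms, symmetric]) auto
    \<comment> \<open>The fundamental theorem of calculus wants a closed interval; the added
      endpoint is a null set.\<close>
    also have "\<dots> = (\<integral>x. (f x * indicator {0..2 * pi} x) / (2 * pi) \<partial>lborel)"
      using AE_lborel_singleton[of "2 * pi"]
      by (intro integral_cong_AE) (auto split: split_indicator elim!: eventually_mono)
    also have "\<dots> = (F (2 * pi) - F 0) / (2 * pi)"
      using F f by (simp add: integral_FTC_Icc_real continuous_on_eq_continuous_at)
    finally show ?thesis .
  qed
  have int: "integrable M (\<lambda>\<omega>. cis (\<theta> \<omega>))"
    by (rule integrable_const_bound[where B=1]) (auto simp: cis_conv_exp)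
  have "(\<integral>\<omega>. cos (\<theta> \<omega>) \<partial>M) = 0"
    by (subst eq[of sin]) (auto intro: derivative_eq_intros continuous_intros)
  moreover have "(\<integral>\<omega>. sin (\<theta> \<omega>) \<partial>M) = 0"
    by (subst eq[of "\<lambda>x. - cos x"]) (auto intro!: derivative_eq_intros continuous_intros)
  ultimately show ?thesis
    using integral_Re[OF int] integral_Im[OF int] by (simp add: complex_eq_iff)
qed

text \<open>This yields positive semidefiniteness of channel covariances and also identifies each
  interference power with a quadratic form in the weights.\<close>

lemma second_moment_form:
  assumes "\<And>i. all_moments (\<lambda>\<omega>. X \<omega> $ i)"
    and "\<And>i j. (\<integral>\<omega>. X \<omega> $ i * cnj (X \<omega> $ j) \<partial>M) = S $ i $ j"
  shows "cdot v (S *v v) = of_real (\<integral>\<omega>. (cmod (cdot v (X \<omega>)))\<^sup>2 \<partial>M)"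
proof -
  have "of_real ((cmod (cdot v (X \<omega>)))\<^sup>2) = (\<Sum>i\<in>UNIV. \<Sum>j\<in>UNIV. cnj (v $ i) * v $ j * (X \<omega> $ i * cnj (X \<omega> $ j)))" for \<omega>
    unfolding complex_norm_square cdot_def cnj_sum sum_product by (simp add: mult_ac)
  moreover have "integrable M (\<lambda>\<omega>. X \<omega> $ i * cnj (X \<omega> $ j))" for i j
    by (intro all_moments_integrable all_moments_intros assms)
  ultimately have "(\<integral>\<omega>. of_real ((cmod (cdot v (X \<omega>)))\<^sup>2) \<partial>M) = (\<Sum>i\<in>UNIV. \<Sum>j\<in>UNIV. cnj (v $ i) * v $ j * S $ i $ j)"
    by (simp add: assms(2))
  then show ?thesis
    by (simp add: cdot_def matrix_vector_mult_def sum_distrib_left mult_ac del: of_real_power)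
qed

subsection \<open>The signal-to-interference-and-noise ratio\<close>

text \<open>For a fixed user the effective gains of all base stations on one pilot form a random
  vector with second moment matrix \<open>C_mat\<close>, and with mean \<open>b_vec\<close> on the
  user's own pilot. The equation is stated over the complex numbers because the quadratic forms on
  the right are complex-valued.\<close>

lemma SINR_expansion:
  fixes a :: "'l::finite \<Rightarrow> 'k::finite \<Rightarrow> complex^'l" and w :: "'l \<Rightarrow> 'k \<Rightarrow> 'a \<Rightarrow> complex^'m"
  assumes mom: "\<And>k' r. all_moments (\<lambda>\<omega>. cdot (w r k' \<omega>) (g l k r \<omega>))"
  shows "complex_of_real (SINR M \<sigma>2 a w g l k) =
     complex_of_real ((cmod (cdot (a l k) (b_vec M w g l k)))\<^sup>2) /
     ((\<Sum>r\<in>UNIV. cdot (a r k) (C_mat M w g l k k *v a r k))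
      - complex_of_real ((cmod (cdot (a l k) (b_vec M w g l k)))\<^sup>2)
      + (\<Sum>r\<in>UNIV. \<Sum>k'\<in>UNIV - {k}. cdot (a r k') (C_mat M w g l k k' *v a r k'))
      + complex_of_real \<sigma>2)"
proof -
  define W where "W k' \<omega> = (\<chi> r. cdot (w r k' \<omega>) (g l k r \<omega>))" for k' \<omega>
  have W: "all_moments (\<lambda>\<omega>. W k' \<omega> $ r)" for k' r using mom by (simp add: W_def)
  have "(\<integral>\<omega>. W k' \<omega> $ r * cnj (W k' \<omega> $ n) \<partial>M) = C_mat M w g l k k' $ r $ n" for k' r n
    by (simp add: W_def C_mat_def flip: cdot_commute)
  note form = second_moment_form[OF W this]
  have NI: "NI a w g l k r k' \<omega> = cdot (a r k') (W k' \<omega>)" for r k' \<omega>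
    by (simp add: NI_def cdot_def[of "a r k'"] W_def)
  have PC: "PC a w g l k r \<omega> = cdot (a r k) (W k \<omega>)" for r \<omega>
    by (simp add: PC_def cdot_def[of "a r k"] W_def)
  have DS: "DS M a w g l k = cdot (a l k) (b_vec M w g l k)"
    by (simp add: DS_def cdot_def[of "a l k"] b_vec_def)
  define f where "f \<omega> = cdot (a l k) (W k \<omega>)" for \<omega>
  define d where "d = cdot (a l k) (b_vec M w g l k)"
  have f: "all_moments f"
    unfolding f_def[abs_def] cdot_def by (intro all_moments_intros W)
  have Ef: "(\<integral>\<omega>. f \<omega> \<partial>M) = d"
    unfolding f_def d_def cdot_def using all_moments_integrable[OF W]
    by (simp add: b_vec_def W_def)
  have BU: "BU M a w g l k \<omega> = f \<omega> - d" for \<omega>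
    by (simp add: BU_def f_def d_def cdot_def[of "a l k"] W_def b_vec_def right_diff_distrib sum_subtractf)
  \<comment> \<open>The beamforming uncertainty is the centred gain \<open>f - d\<close>, so its
    power is the second moment of \<open>f\<close> minus |d|^2.\<close>
  have "complex_of_real (\<integral>\<omega>. (cmod (BU M a w g l k \<omega>))\<^sup>2 \<partial>M) = (\<integral>\<omega>. of_real ((cmod (f \<omega>))\<^sup>2) - cnj d * f \<omega> - d * cnj (f \<omega>) + d * cnj d \<partial>M)"
    unfolding BU integral_complex_of_real[symmetric] complex_norm_square by (simp add: algebra_simps)
  also have "\<dots> = (\<integral>\<omega>. of_real ((cmod (f \<omega>))\<^sup>2) \<partial>M) - d * cnj d"
  proof -
    have "integrable M (\<lambda>\<omega>. complex_of_real ((cmod (f \<omega>))\<^sup>2))"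
      unfolding complex_norm_square by (intro all_moments_integrable all_moments_intros f)
    moreover have "integrable M f" "integrable M (\<lambda>\<omega>. cnj (f \<omega>))"
      by (intro all_moments_integrable all_moments_intros f)+
    ultimately show ?thesis by (simp add: Ef prob_space)
  qed
  finally have BU2: "complex_of_real (\<integral>\<omega>. (cmod (BU M a w g l k \<omega>))\<^sup>2 \<partial>M) =
      cdot (a l k) (C_mat M w g l k k *v a l k) - of_real ((cmod d)\<^sup>2)"
    unfolding form f_def complex_norm_square[of d] by (simp del: of_real_power)
  \<comment> \<open>The second moment found for the beamforming uncertainty is the r = l term
    missing from the pilot contamination sum.\<close>
  have "(\<Sum>r\<in>UNIV. cdot (a r k) (C_mat M w g l k k *v a r k)) = cdot (a l k) (C_mat M w g l k k *v a l k)
     + (\<Sum>r\<in>UNIV - {l}. cdot (a r k) (C_mat M w g l k k *v a r k))"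
    by (rule sum.remove) auto
  then show ?thesis
    unfolding SINR_def of_real_divide of_real_add of_real_sum BU2 NI PC DS form[symmetric] d_def by simp
qed

end

subsection \<open>The multi-cell system\<close>

text \<open>The constant \<open>c\<close> is the pilot energy \<tau>p * \<eta>, the only combination
  in which the two enter the observations and the estimates.\<close>

locale multicell = prob_space P
  for P :: "'w measure" +
  fixes \<theta> :: "'l::finite \<Rightarrow> 'k::finite \<Rightarrow> 'l \<Rightarrow> 'w \<Rightarrow> real"
    and gt g :: "'l \<Rightarrow> 'k \<Rightarrow> 'l \<Rightarrow> 'w \<Rightarrow> complex^'m::finite"
    and nt z ghat :: "'l \<Rightarrow> 'k \<Rightarrow> 'w \<Rightarrow> complex^'m"
    and gbar :: "'l \<Rightarrow> 'k \<Rightarrow> 'l \<Rightarrow> complex^'m"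
    and R Rbar :: "'l \<Rightarrow> 'k \<Rightarrow> 'l \<Rightarrow> complex^'m^'m"
    and \<Psi> :: "'l \<Rightarrow> 'k \<Rightarrow> complex^'m^'m"
    and c \<sigma>2 :: real
  assumes c: "c > 0" and \<sigma>2: "\<sigma>2 > 0"
    and phase: "\<And>l k r. distributed P lborel (\<theta> l k r)
                  (\<lambda>x. ennreal (indicator {0..<2 * pi} x / (2 * pi)))"
    and scatter: "\<And>l k r. circ_gaussian P (gt l k r) (R l k r)"
    and noise: "\<And>l k. circ_gaussian P (nt l k) (mat (complex_of_real \<sigma>2))"
    and indep: "indep_sets (source_events P \<theta> gt nt) UNIV"
    and channel: "\<And>l k r \<omega>. g l k r \<omega> = cis (\<theta> l k r \<omega>) *s gbar l k r + gt l k r \<omega>"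
    and pilot: "\<And>l k \<omega>. z l k \<omega> = sqrt c *\<^sub>R (\<Sum>r\<in>UNIV. g r k l \<omega>) + nt l k \<omega>"
    and Rbar: "\<And>l k r. Rbar l k r = (\<integral>\<omega>. outer (g l k r \<omega>) (g l k r \<omega>) \<partial>P)"
    and Psi: "\<And>l k. \<Psi> l k = (\<integral>\<omega>. outer (z l k \<omega>) (z l k \<omega>) \<partial>P)"
    and lmmse: "\<And>l k \<omega>. ghat l k \<omega> = sqrt c *\<^sub>R ((Rbar l k l ** matrix_inv (\<Psi> l k)) *v z l k \<omega>)"
begin

section \<open>Sigma-algebras generated by groups of sources\<close>

definition generated :: "('l, 'k) source set \<Rightarrow> 'w measure"
  where "generated A = sigma (space P) (\<Union>s\<in>A. source_events P \<theta> gt nt s)"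

lemma source_events_subset: "source_events P \<theta> gt nt s \<subseteq> Pow (space P)"
  by (cases s) auto

lemma space_generated [simp]: "space (generated A) = space P"
  unfolding generated_def by (rule space_measure_of) (use source_events_subset in blast)

lemma sets_generated: "sets (generated A) = sigma_sets (space P) (\<Union>s\<in>A. source_events P \<theta> gt nt s)"
  unfolding generated_def by (rule sets_measure_of) (use source_events_subset in blast)

lemma source_events_generated: "s \<in> A \<Longrightarrow> source_events P \<theta> gt nt s \<subseteq> sets (generated A)"
  unfolding sets_generated by auto

lemma Int_stable_source_events: "Int_stable (source_events P \<theta> gt nt s)"
  by (cases s) (simp_all add: Int_stable_vimage)

text \<open>Mutual independence of pi-systems passes to the sigma-algebras of disjoint blocks. Every
  later independence claim thereby becomes disjointness of two sets of sources.\<close>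

lemma indep_generated:
  assumes "A \<inter> B = {}"
  shows "indep_algebras (generated A) (generated B)"
proof -
  have "indep_sets (\<lambda>j. sigma_sets (space P) (\<Union>i\<in>case_bool A B j. source_events P \<theta> gt nt i)) UNIV"
  proof (rule indep_sets_collect_sigma)
    show "indep_sets (source_events P \<theta> gt nt) (\<Union>j\<in>UNIV. case_bool A B j)"
      using indep by (rule indep_sets_mono_index[rotated]) simp
    show "disjoint_family_on (case_bool A B) UNIV"
      using assms by (auto simp: disjoint_family_on_def split: bool.split)
  qed (rule Int_stable_source_events)
  then have "indep_sets (case_bool (sets (generated A)) (sets (generated B))) UNIV"
    by (rule indep_sets_mono) (auto simp: sets_generated split: bool.split_asm)
  then show ?thesis by (simp add: indep_algebras_def indep_set_def)
qed

lemma source_measurable: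
  "Phase l k r \<in> A \<Longrightarrow> \<theta> l k r \<in> borel_measurable (generated A)"
  "Scatter l k r \<in> A \<Longrightarrow> gt l k r \<in> borel_measurable (generated A)"
  "Noise l k \<in> A \<Longrightarrow> nt l k \<in> borel_measurable (generated A)"
  by (rule measurableI; use source_events_generated[of _ A] in force)+

lemma channel_measurable:
  assumes "Phase l k r \<in> A" "Scatter l k r \<in> A"
  shows "(\<lambda>\<omega>. g l k r \<omega> $ i) \<in> borel_measurable (generated A)"
proof -
  note [measurable] = source_measurable(1)[OF assms(1)] measurable_compose[OF source_measurable(2)[OF assms(2)] borel_measurable_vec_nth]
  note [measurable] = borel_measurable_cis
  show ?thesis by (simp add: channel)
qed

lemma noise_measurable: "Noise l k \<in> A \<Longrightarrow> (\<lambda>\<omega>. nt l k \<omega> $ i) \<in> borel_measurable (generated A)"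
  by (rule measurable_compose[OF source_measurable(3) borel_measurable_vec_nth])

lemma phase_measurable: "(\<lambda>\<omega>. cis (\<theta> l k r \<omega>)) \<in> borel_measurable P"
  by (rule measurable_compose[of "\<theta> l k r", OF _ borel_measurable_cis]) (use distributed_measurable[OF phase] in simp)

lemma phase_generated: "(\<lambda>\<omega>. cis (\<theta> l k r \<omega>)) \<in> borel_measurable (generated {Phase l k r})"
  by (rule measurable_compose[OF source_measurable(1) borel_measurable_cis]) simp

lemma scatter_generated: "(\<lambda>\<omega>. gt l k r \<omega> $ i) \<in> borel_measurable (generated {Scatter l k r})"
  by (rule measurable_compose[OF source_measurable(2) borel_measurable_vec_nth]) simp

lemma indep_phase_scatter: "indep_algebras (generated {Phase l k r}) (generated {Scatter l k r})"
  by (rule indep_generated) simp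

text \<open>The phase and the scattered part of one channel play the roles of \<open>p\<close> and
  \<open>G\<close>, each with the sigma-algebra of its single source.\<close>

lemmas rician_assms = phase_generated norm_cis phase_measurable uniform_phase_mean[OF phase]
  scatter scatter_generated indep_phase_scatter channel

lemmas channel_all_moments = rician_all_moments[OF rician_assms]
  and channel_mean = rician_mean[OF rician_assms]
  and channel_covariance = rician_covariance[OF rician_assms]
  and channel_quadratic = rician_quadratic[OF rician_assms]

section \<open>Second-order statistics of channels and pilot observations\<close>

lemma noise_all_moments: "all_moments (\<lambda>\<omega>. nt l k \<omega> $ i)"
  by (rule circ_gaussian_all_moments[OF noise])

lemma pilot_nth: "z l k \<omega> $ i = of_real (sqrt c) * (\<Sum>r\<in>UNIV. g r k l \<omega> $ i) + nt l k \<omega> $ i"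
  by (simp add: pilot scaleR_conv_of_real[where 'a=complex])

lemma pilot_all_moments: "all_moments (\<lambda>\<omega>. z l k \<omega> $ i)"
  unfolding pilot_nth by (intro all_moments_intros channel_all_moments noise_all_moments)

lemma outer_integral:
  assumes "\<And>i. all_moments (\<lambda>\<omega>. X \<omega> $ i)"
  shows "(\<integral>\<omega>. outer (X \<omega>) (X \<omega>) \<partial>P) $ i $ j = (\<integral>\<omega>. X \<omega> $ i * cnj (X \<omega> $ j) \<partial>P)"
proof -
  have m: "integrable P (\<lambda>\<omega>. outer (X \<omega>) (X \<omega>) $ i $ j)" for i j
    unfolding outer_def using assms by (auto intro!: all_moments_integrable all_moments_intros)
  then show ?thesis
    by (simp add: integral_vec_nth integrable_vec) (simp add: outer_def)
qed

lemma Rbar_eq: "Rbar l k r = R l k r + outer (gbar l k r) (gbar l k r)"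
  unfolding vec_eq_iff Rbar outer_integral[OF channel_all_moments] channel_covariance by simp

lemma channel_second_moment: "(\<integral>\<omega>. g l k r \<omega> $ i * cnj (g l k r \<omega> $ j) \<partial>P) = Rbar l k r $ i $ j"
  unfolding Rbar_eq by (rule channel_covariance)

lemma pilot_second_moment: "(\<integral>\<omega>. z l k \<omega> $ i * cnj (z l k \<omega> $ j) \<partial>P) = \<Psi> l k $ i $ j"
  unfolding Psi by (rule outer_integral[OF pilot_all_moments, symmetric])

lemma channel_uncorrelated:
  assumes "(l, k, r) \<noteq> (l', k', r')"
  shows "(\<integral>\<omega>. g l k r \<omega> $ i * cnj (g l' k' r' \<omega> $ j) \<partial>P) = 0"
proof -
  have "{Phase l k r, Scatter l k r} \<inter> {Phase l' k' r', Scatter l' k' r'} = {}" using assms by auto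
  note ind = indep_generated[OF this]
  show ?thesis
    by (subst indep_algebras_integral_mult[OF ind])
       (auto intro!: channel_measurable measurable_compose[OF channel_measurable borel_measurable_cnj]
          channel_all_moments all_moments_cnj simp: channel_mean)
qed

lemma channel_noise_uncorrelated:
  "(\<integral>\<omega>. g l k r \<omega> $ i * cnj (nt l' k' \<omega> $ j) \<partial>P) = 0"
proof -
  have "{Phase l k r, Scatter l k r} \<inter> {Noise l' k'} = {}" by auto
  note ind = indep_generated[OF this]
  show ?thesis
    by (subst indep_algebras_integral_mult[OF ind])
       (auto intro!: channel_measurable measurable_compose[OF noise_measurable borel_measurable_cnj]
          channel_all_moments noise_all_moments all_moments_cnj simp: channel_mean)
qed

lemma Psi_eq: "\<Psi> l k = c *\<^sub>R (\<Sum>r\<in>UNIV. Rbar r k l) + mat (complex_of_real \<sigma>2)"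
proof -
  note mom = all_moments_intros channel_all_moments noise_all_moments
  have "\<Psi> l k $ i $ j = (c *\<^sub>R (\<Sum>r\<in>UNIV. Rbar r k l) + mat (complex_of_real \<sigma>2)) $ i $ j" for i j
  proof -
    have cc: "complex_of_real (sqrt c) * complex_of_real (sqrt c) = of_real c"
      using c by (simp flip: of_real_mult)
    \<comment> \<open>The noise-channel product is written as the conjugate of a channel-noise
      product, so that \<open>channel_noise_uncorrelated\<close> removes both mixed sums.\<close>
    have eq: "z l k \<omega> $ i * cnj (z l k \<omega> $ j) =
      of_real c * (\<Sum>r\<in>UNIV. \<Sum>r'\<in>UNIV. g r k l \<omega> $ i * cnj (g r' k l \<omega> $ j))
      + of_real (sqrt c) * (\<Sum>r\<in>UNIV. g r k l \<omega> $ i * cnj (nt l k \<omega> $ j))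
      + of_real (sqrt c) * (\<Sum>r\<in>UNIV. cnj (g r k l \<omega> $ j * cnj (nt l k \<omega> $ i)))
      + nt l k \<omega> $ i * cnj (nt l k \<omega> $ j)" for \<omega>
      unfolding pilot_nth cc[symmetric] sum_product[symmetric] sum_distrib_right[symmetric]
      by (simp add: algebra_simps sum_distrib_left)
    have "integrable P (\<lambda>\<omega>. g r k l \<omega> $ i * cnj (g r' k l \<omega> $ j))"
      "integrable P (\<lambda>\<omega>. g r k l \<omega> $ i * cnj (nt l k \<omega> $ j))"
      "integrable P (\<lambda>\<omega>. cnj (g r k l \<omega> $ j * cnj (nt l k \<omega> $ i)))"
      "integrable P (\<lambda>\<omega>. nt l k \<omega> $ i * cnj (nt l k \<omega> $ j))" for r r'
      by (intro all_moments_integrable mom)+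
    then have "\<Psi> l k $ i $ j =
      of_real c * (\<Sum>r\<in>UNIV. \<Sum>r'\<in>UNIV. (\<integral>\<omega>. g r k l \<omega> $ i * cnj (g r' k l \<omega> $ j) \<partial>P))
      + (\<integral>\<omega>. nt l k \<omega> $ i * cnj (nt l k \<omega> $ j) \<partial>P)"
      unfolding pilot_second_moment[symmetric] eq
      by (simp add: channel_noise_uncorrelated Bochner_Integration.integral_cnj del: complex_cnj_mult)
    moreover have "(\<integral>\<omega>. g r k l \<omega> $ i * cnj (g r' k l \<omega> $ j) \<partial>P) = (if r' = r then Rbar r k l $ i $ j else 0)" for r r'
      by (auto simp: channel_second_moment intro: channel_uncorrelated)
    ultimately show ?thesis
      by (simp add: circ_gaussian_covariance[OF noise] scaleR_conv_of_real[where 'a=complex])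
  qed
  then show ?thesis by (simp add: vec_eq_iff)
qed

text \<open>The form v^H \<Psi> v is a nonnegative sum over the cells plus \<sigma>2 times the
  squared norm of \<open>v\<close>; the positive noise variance makes it definite even when all
  channel covariances are singular.\<close>

lemma Psi_nonsingular:
  assumes "\<Psi> l k *v v = 0"
  shows "v = 0"
proof (rule ccontr)
  assume "v \<noteq> 0"
  then obtain i where i: "v $ i \<noteq> 0" by (auto simp: vec_eq_iff)
  have R: "Re (cdot v (Rbar r k l *v v)) \<ge> 0" for r
    by (subst second_moment_form[OF channel_all_moments channel_second_moment]) simp
  have "cdot v (\<Psi> l k *v v) = of_real c * (\<Sum>r\<in>UNIV. cdot v (Rbar r k l *v v)) + of_real \<sigma>2 * cdot v v"
  proof -
    have "(c *\<^sub>R S) *v v = c *\<^sub>R (S *v v)" for S :: "complex^'m^'m"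
      by (simp add: vec_eq_iff matrix_vector_mult_def scaleR_sum_right)
    moreover have "(\<Sum>r\<in>UNIV. Rbar r k l) *v v = (\<Sum>r\<in>UNIV. Rbar r k l *v v)"
      by (simp add: vec_eq_iff matrix_vector_mult_def sum_distrib_right) (auto intro: sum.swap)
    moreover have "mat (complex_of_real \<sigma>2) *v v = \<sigma>2 *\<^sub>R v"
      by (simp add: vec_eq_iff matrix_vector_mult_def mat_def if_distrib[of "\<lambda>x. x * _"] scaleR_conv_of_real[where 'a=complex] cong: if_cong)
    moreover have "cdot v (\<Sum>r\<in>UNIV. f r) = (\<Sum>r\<in>UNIV. cdot v (f r))" for f :: "'l \<Rightarrow> complex^'m"
      by (simp add: cdot_def sum_distrib_left) (rule sum.swap)
    ultimately show ?thesis
      by (simp add: Psi_eq matrix_vector_mult_add_rdistrib cdot_add_right cdot_scaleR_right)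
  qed
  then have "0 = c * (\<Sum>r\<in>UNIV. Re (cdot v (Rbar r k l *v v))) + \<sigma>2 * Re (cdot v v)"
    using assms by (simp add: cdot_def[of v 0] complex_eq_iff)
  moreover have "c * (\<Sum>r\<in>UNIV. Re (cdot v (Rbar r k l *v v))) \<ge> 0"
    using c R by (intro mult_nonneg_nonneg sum_nonneg) auto
  moreover have "Re (cdot v v) > 0"
  proof -
    have "Re (cdot v v) = (\<Sum>i\<in>UNIV. (cmod (v $ i))\<^sup>2)"
      by (simp add: cdot_def cmod_power2) (simp add: power2_eq_square)
    also have "\<dots> > 0" using i by (intro sum_pos2[of _ i]) auto
    finally show ?thesis .
  qed
  ultimately show False using mult_pos_pos[OF \<sigma>2] by (metis add_nonneg_pos less_irrefl)
qed

lemma herm_second_moment: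
  assumes "\<And>i j. (\<integral>\<omega>. X \<omega> $ i * cnj (X \<omega> $ j) \<partial>P) = S $ i $ j"
  shows "herm S = S"
proof -
  have "cnj (S $ j $ i) = S $ i $ j" for i j
    unfolding assms[symmetric] Bochner_Integration.integral_cnj[symmetric] by (simp add: mult.commute)
  then show ?thesis by (simp add: herm_def vec_eq_iff)
qed

lemmas herm_Rbar = herm_second_moment[OF channel_second_moment]
  and herm_R = herm_second_moment[OF circ_gaussian_covariance[OF scatter]]
  and herm_Psi = herm_second_moment[OF pilot_second_moment]

section \<open>The estimate as a form in the observation\<close>

lemma herm_lmmse: "herm (Rbar l k l ** matrix_inv (\<Psi> l k)) = matrix_inv (\<Psi> l k) ** Rbar l k l"
  by (simp add: herm_mult herm_Rbar herm_matrix_inv[OF Psi_nonsingular herm_Psi])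

lemma herm_lmmse': "herm (matrix_inv (\<Psi> l k) ** Rbar l k l) = Rbar l k l ** matrix_inv (\<Psi> l k)"
  by (simp flip: herm_lmmse)

text \<open>Moving the estimation filter across the inner product reverses its Hermitian factors,
  which produces the matrix \<open>B\<close> of the observation lemmas.\<close>

lemma cdot_estimate:
  "cdot (ghat r k \<omega>) x = of_real (sqrt c) * cdot (z r k \<omega>) ((matrix_inv (\<Psi> r k) ** Rbar r k r) *v x)"
  by (simp add: lmmse cdot_scaleR_left cdot_mult_left herm_lmmse)

lemma estimate_all_moments: "all_moments (\<lambda>\<omega>. cdot (ghat r k' \<omega>) (g l k r \<omega>))"
  unfolding cdot_estimate
  by (intro all_moments_intros all_moments_cdot all_moments_matrix_vector_mult pilot_all_moments channel_all_moments)

lemma pilot_measurable: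
  assumes "Noise l k \<in> A" "\<And>r. Phase r k l \<in> A" "\<And>r. Scatter r k l \<in> A"
  shows "(\<lambda>\<omega>. z l k \<omega> $ i) \<in> borel_measurable (generated A)"
  unfolding pilot_nth using assms
  by (intro borel_measurable_add borel_measurable_times borel_measurable_sum borel_measurable_const channel_measurable noise_measurable)

lemma estimate_measurable:
  assumes "Noise r k' \<in> A" "\<And>n k. Phase n k r \<in> A" "\<And>n k. Scatter n k r \<in> A"
  shows "(\<lambda>\<omega>. cdot (ghat r k' \<omega>) (g l k r \<omega>)) \<in> borel_measurable (generated A)"
proof -
  have [measurable]: "(\<lambda>\<omega>. z r k' \<omega> $ i) \<in> borel_measurable (generated A)"
    "(\<lambda>\<omega>. g l k r \<omega> $ i) \<in> borel_measurable (generated A)" for i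
    using assms by (auto intro: pilot_measurable channel_measurable)
  show ?thesis
    unfolding cdot_estimate unfolding cdot_def matrix_vector_mult_def by simp
qed

lemma observation:
  fixes l r k
  defines "Y \<equiv> \<lambda>\<omega>. sqrt c *\<^sub>R (\<Sum>n\<in>UNIV - {l}. g n k r \<omega>) + nt r k \<omega>"
    and "A \<equiv> insert (Noise r k) ((\<lambda>n. Phase n k r) ` (UNIV - {l}) \<union> (\<lambda>n. Scatter n k r) ` (UNIV - {l}))"
  shows "indep_algebras (generated {Phase l k r, Scatter l k r}) (generated A)"
    and "(\<lambda>\<omega>. Y \<omega> $ i) \<in> borel_measurable (generated A)"
    and "all_moments (\<lambda>\<omega>. Y \<omega> $ i)"
    and "z r k \<omega> = sqrt c *\<^sub>R g l k r \<omega> + Y \<omega>"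
    and "(\<integral>\<omega>. Y \<omega> $ i \<partial>P) = 0"
proof -
  show "indep_algebras (generated {Phase l k r, Scatter l k r}) (generated A)"
    by (rule indep_generated) (auto simp: A_def)
  have nth: "Y \<omega> $ i = of_real (sqrt c) * (\<Sum>n\<in>UNIV - {l}. g n k r \<omega> $ i) + nt r k \<omega> $ i" for \<omega> i
    by (simp add: Y_def scaleR_conv_of_real[where 'a=complex])
  show "(\<lambda>\<omega>. Y \<omega> $ i) \<in> borel_measurable (generated A)"
    unfolding nth
    by (intro borel_measurable_add borel_measurable_times borel_measurable_sum borel_measurable_const
        channel_measurable noise_measurable) (auto simp: A_def)
  show "all_moments (\<lambda>\<omega>. Y \<omega> $ i)"
    unfolding nth by (intro all_moments_intros channel_all_moments noise_all_moments)
  show "z r k \<omega> = sqrt c *\<^sub>R g l k r \<omega> + Y \<omega>"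
    by (simp add: pilot Y_def sum.remove[of UNIV l] scaleR_add_right)
  have "integrable P (\<lambda>\<omega>. g n k r \<omega> $ i)" "integrable P (\<lambda>\<omega>. nt r k \<omega> $ i)" for n
    by (intro all_moments_integrable channel_all_moments noise_all_moments)+
  then show "(\<integral>\<omega>. Y \<omega> $ i \<partial>P) = 0"
    unfolding nth by (simp add: channel_mean circ_gaussian_mean[OF noise])
qed

lemmas observation_assms =
  observation(1) channel_measurable[OF insertI1 insertI2[OF insertI1]] channel_all_moments
  observation(2,3,4,5) channel_second_moment

lemma b_vec_eq:
  "b_vec P ghat g l k $ r = of_real c * trace (matrix_inv (\<Psi> r k) ** Rbar r k r ** Rbar l k r)"
proof -
  \<comment> \<open>One root of \<open>c\<close> comes from the estimation filter, the other from
    the amplitude of the channel in the observation.\<close>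
  have cc: "complex_of_real (sqrt c) * complex_of_real (sqrt c) = of_real c"
    using c by (simp flip: of_real_mult)
  show ?thesis
    by (simp add: b_vec_def cdot_estimate observation_bilinear[OF observation_assms pilot_second_moment] flip: cc)
qed

lemma C_mat_nth: "C_mat P ghat g l k k' $ r $ n =
  (\<integral>\<omega>. cdot (ghat r k' \<omega>) (g l k r \<omega>) * cnj (cdot (ghat n k' \<omega>) (g l k n \<omega>)) \<partial>P)"
  by (simp add: C_mat_def flip: cdot_commute)

lemma C_mat_diag: "C_mat P ghat g l k k' $ r $ r = of_real c *
  (\<integral>\<omega>. cdot (z r k' \<omega>) ((matrix_inv (\<Psi> r k') ** Rbar r k' r) *v g l k r \<omega>) *
    cnj (cdot (z r k' \<omega>) ((matrix_inv (\<Psi> r k') ** Rbar r k' r) *v g l k r \<omega>)) \<partial>P)"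
proof -
  have cc: "complex_of_real (sqrt c) * complex_of_real (sqrt c) = of_real c"
    using c by (simp flip: of_real_mult)
  have "of_real (sqrt c) * x * cnj (of_real (sqrt c) * x) = of_real c * (x * cnj x)" for x :: complex
    by (simp add: mult_ac flip: cc)
  then show ?thesis
    unfolding C_mat_nth cdot_estimate by (simp only: integral_mult_right_zero)
qed

text \<open>All sources behind the signal at a station carry that station as receiver index. Two
  stations thus share no source, and their gains are independent although they concern the same
  user.\<close>

lemma C_mat_offdiag:
  assumes "r \<noteq> n"
  shows "C_mat P ghat g l k k' $ r $ n =
    (\<integral>\<omega>. cdot (ghat r k' \<omega>) (g l k r \<omega>) \<partial>P) * cnj (\<integral>\<omega>. cdot (ghat n k' \<omega>) (g l k n \<omega>) \<partial>P)"
proof -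
  define A where "A r = insert (Noise r k') (range (\<lambda>(n, k). Phase n k r) \<union> range (\<lambda>(n, k). Scatter n k r))" for r :: 'l
  have "A r \<inter> A n = {}" using assms by (auto simp: A_def)
  note ind = indep_generated[OF this]
  have m: "(\<lambda>\<omega>. cdot (ghat r k' \<omega>) (g l k r \<omega>)) \<in> borel_measurable (generated (A r))" for r
    by (rule estimate_measurable) (auto simp: A_def)
  show ?thesis
    unfolding C_mat_nth Bochner_Integration.integral_cnj[symmetric]
    by (intro indep_algebras_integral_mult[OF ind] m measurable_compose[OF m borel_measurable_cnj]
      estimate_all_moments all_moments_cnj)
qed

text \<open>The conjugate transpose of the filter ends in the inverse of \<Psi>, which absorbs the
  trailing \<Psi>; cyclicity of the trace then moves the remaining covariance to the front. The
  matrix \<open>S\<close> is left general to serve equal and different pilots.\<close>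

lemma trace_lmmse:
  "trace (matrix_inv (\<Psi> r k) ** Rbar r k r ** S ** herm (matrix_inv (\<Psi> r k) ** Rbar r k r) ** \<Psi> r k) =
    trace (Rbar r k r ** matrix_inv (\<Psi> r k) ** Rbar r k r ** S)"
proof -
  have "Rbar r k r ** matrix_inv (\<Psi> r k) ** \<Psi> r k = Rbar r k r"
    by (simp add: matrix_inv_mult_left[OF Psi_nonsingular] flip: matrix_mul_assoc)
  then have "trace (matrix_inv (\<Psi> r k) ** Rbar r k r ** S ** herm (matrix_inv (\<Psi> r k) ** Rbar r k r) ** \<Psi> r k) =
     trace (matrix_inv (\<Psi> r k) ** Rbar r k r ** S ** Rbar r k r)"
    unfolding herm_lmmse' by (metis matrix_mul_assoc)
  also have "\<dots> = trace (Rbar r k r ** (matrix_inv (\<Psi> r k) ** Rbar r k r ** S))"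
    by (rule trace_mul_sym)
  finally show ?thesis by (simp add: matrix_mul_assoc)
qed

lemma indep_other_pilot:
  assumes "k' \<noteq> k"
  shows "indep_algebras (generated {Phase l k r, Scatter l k r})
    (generated (insert (Noise r k') (range (\<lambda>n. Phase n k' r) \<union> range (\<lambda>n. Scatter n k' r))))"
  using assms by (intro indep_generated) auto

lemma C_mat_diag_other:
  assumes "k' \<noteq> k"
  shows "C_mat P ghat g l k k' $ r $ r =
    of_real c * trace (Rbar r k' r ** matrix_inv (\<Psi> r k') ** Rbar r k' r ** Rbar l k r)"
  unfolding C_mat_diag trace_lmmse[symmetric]
  by (subst expectation_quadratic_indep[OF indep_other_pilot[OF assms] channel_measurable channel_all_moments
     pilot_measurable pilot_all_moments channel_second_moment pilot_second_moment]) auto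

text \<open>The channel has mean zero and is independent of the observation on another pilot, so
  their cross-covariance is the zero matrix.\<close>

lemma estimate_other_mean:
  assumes "k' \<noteq> k"
  shows "(\<integral>\<omega>. cdot (ghat r k' \<omega>) (g l k r \<omega>) \<partial>P) = 0"
proof -
  have "(\<integral>\<omega>. g l k r \<omega> $ i * cnj (z r k' \<omega> $ j) \<partial>P) = 0" for i j
  proof (subst indep_algebras_integral_mult[OF indep_other_pilot[OF assms]])
    show "(\<lambda>\<omega>. cnj (z r k' \<omega> $ j)) \<in> borel_measurable (generated
        (insert (Noise r k') (range (\<lambda>n. Phase n k' r) \<union> range (\<lambda>n. Scatter n k' r))))"
      by (rule measurable_compose[OF pilot_measurable borel_measurable_cnj]) auto
  qed (auto intro: channel_measurable channel_all_moments all_moments_cnj pilot_all_moments simp: channel_mean)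
  then have "(\<integral>\<omega>. cdot (z r k' \<omega>) (B *v g l k r \<omega>) \<partial>P) = trace (B ** 0)" for B
    by (intro expectation_bilinear channel_all_moments pilot_all_moments) simp
  then show ?thesis by (simp add: cdot_estimate trace_def matrix_matrix_mult_def)
qed

lemma C_mat_diag_same:
  "C_mat P ghat g l k k $ r $ r =
    of_real (c\<^sup>2 * (cmod (trace (R l k r ** Rbar r k r ** matrix_inv (\<Psi> r k))))\<^sup>2)
    + of_real (2 * c\<^sup>2 * Re (cdot (gbar l k r) ((Rbar r k r ** matrix_inv (\<Psi> r k)) *v gbar l k r) *
        trace (matrix_inv (\<Psi> r k) ** Rbar r k r ** R l k r)))
    + of_real c * trace (Rbar r k r ** matrix_inv (\<Psi> r k) ** Rbar r k r ** Rbar l k r)"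
proof -
  define B where "B = matrix_inv (\<Psi> r k) ** Rbar r k r"
  define t where "t = trace (B ** R l k r)"
  define q where "q = cdot (gbar l k r) (B *v gbar l k r)"
  have tr: "trace (B ** Rbar l k r) = t + q"
    by (simp add: Rbar_eq[of l] matrix_add_ldistrib trace_add trace_mult_outer t_def q_def)
  \<comment> \<open>The stated form contains the filter itself, \<open>q\<close> its conjugate
    transpose; so the two are complex conjugates.\<close>
  have q: "cdot (gbar l k r) ((Rbar r k r ** matrix_inv (\<Psi> r k)) *v gbar l k r) = cnj q"
    unfolding q_def B_def herm_lmmse'[symmetric] cdot_mult_left[symmetric] by (rule cdot_commute)
  have "cnj t = trace (herm (B ** R l k r))" by (simp add: t_def trace_herm)
  also have "herm (B ** R l k r) = R l k r ** Rbar r k r ** matrix_inv (\<Psi> r k)"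
    unfolding herm_mult[of B] herm_R unfolding B_def herm_lmmse' matrix_mul_assoc ..
  finally have t: "cmod (trace (R l k r ** Rbar r k r ** matrix_inv (\<Psi> r k))) = cmod t"
    by (metis complex_mod_cnj)
  \<comment> \<open>The leading factor \<open>c\<close> comes from the two estimates, the inner one
    from the channel amplitude in the pilot. The two copies of the trace without \<Psi> cancel in
    the next step.\<close>
  have "C_mat P ghat g l k k $ r $ r = of_real c * (of_real c *
      (trace (B ** Rbar l k r ** herm B ** Rbar l k r) + (t + q) * cnj (t + q) - q * cnj q)
      + trace (B ** Rbar l k r ** herm B ** \<Psi> r k) - of_real c * trace (B ** Rbar l k r ** herm B ** Rbar l k r))"
    unfolding C_mat_diag B_def[symmetric] observation_quadratic[OF observation_assms pilot_second_moment]
      channel_quadratic Rbar_eq[of l k r, symmetric] tr q_def[symmetric]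
    using c by simp
  also have "\<dots> = of_real (c\<^sup>2) * ((t + q) * cnj (t + q) - q * cnj q)
      + of_real c * trace (B ** Rbar l k r ** herm B ** \<Psi> r k)"
    by (simp add: algebra_simps power2_eq_square)
  also have "(t + q) * cnj (t + q) - q * cnj q = of_real ((cmod t)\<^sup>2 + 2 * Re (cnj q * t))"
    by (simp add: complex_eq_iff cmod_power2) (simp add: power2_eq_square algebra_simps)
  also have "trace (B ** Rbar l k r ** herm B ** \<Psi> r k) = trace (Rbar r k r ** matrix_inv (\<Psi> r k) ** Rbar r k r ** Rbar l k r)"
    unfolding B_def by (rule trace_lmmse)
  finally show ?thesis
    unfolding q t B_def[symmetric] t_def[symmetric] by (simp add: algebra_simps)
qed

end

theorem theorem1:
  fixes P :: "'w measure"
    and \<theta> :: "'l::finite \<Rightarrow> 'k::finite \<Rightarrow> 'l \<Rightarrow> 'w \<Rightarrow> real"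
    and gt g :: "'l \<Rightarrow> 'k \<Rightarrow> 'l \<Rightarrow> 'w \<Rightarrow> complex^'m::finite"
    and nt z ghat :: "'l \<Rightarrow> 'k \<Rightarrow> 'w \<Rightarrow> complex^'m"
    and gbar :: "'l \<Rightarrow> 'k \<Rightarrow> 'l \<Rightarrow> complex^'m"
    and R Rbar :: "'l \<Rightarrow> 'k \<Rightarrow> 'l \<Rightarrow> complex^'m^'m"
    and \<Psi> :: "'l \<Rightarrow> 'k \<Rightarrow> complex^'m^'m"
    and \<tau>c \<tau>p :: nat
    and \<eta> \<sigma>2 :: real
    and a :: "'l \<Rightarrow> 'k \<Rightarrow> complex^'l"
    and l :: 'l and k :: 'k
  assumes "prob_space P"
    and "\<tau>p = CARD('k)" and "\<tau>p < \<tau>c" and "\<eta> > 0" and "\<sigma>2 > 0"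
    and phase: "\<And>l k r. distributed P lborel (\<theta> l k r)
                  (\<lambda>x. ennreal (indicator {0..<2 * pi} x / (2 * pi)))"
    and scatter: "\<And>l k r. circ_gaussian P (gt l k r) (R l k r)"
    and noise: "\<And>l k. circ_gaussian P (nt l k) (mat (complex_of_real \<sigma>2))"
    and indep: "prob_space.indep_sets P (source_events P \<theta> gt nt) UNIV"
    and channel: "\<And>l k r \<omega>. g l k r \<omega> = cis (\<theta> l k r \<omega>) *s gbar l k r + gt l k r \<omega>"
    and pilot: "\<And>l k \<omega>. z l k \<omega> =
                  sqrt (real \<tau>p * \<eta>) *\<^sub>R (\<Sum>r\<in>UNIV. g r k l \<omega>) + nt l k \<omega>"
    and Rbar: "\<And>l k r. Rbar l k r = (\<integral>\<omega>. outer (g l k r \<omega>) (g l k r \<omega>) \<partial>P)"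
    and Psi: "\<And>l k. \<Psi> l k = (\<integral>\<omega>. outer (z l k \<omega>) (z l k \<omega>) \<partial>P)"
    and lmmse: "\<And>l k \<omega>. ghat l k \<omega> =
                  sqrt (real \<tau>p * \<eta>) *\<^sub>R ((Rbar l k l ** matrix_inv (\<Psi> l k)) *v z l k \<omega>)"
  shows
    "(\<forall>l k r. Rbar l k r = R l k r + outer (gbar l k r) (gbar l k r)) \<and>
     (\<forall>l k. \<Psi> l k = (real \<tau>p * \<eta>) *\<^sub>R (\<Sum>r\<in>UNIV. Rbar r k l) + mat (complex_of_real \<sigma>2)) \<and>
     SE P \<tau>c \<tau>p \<sigma>2 a ghat g l k =
       (real \<tau>c - real \<tau>p) / real \<tau>c * log 2 (1 + SINR P \<sigma>2 a ghat g l k) \<and>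
     complex_of_real (SINR P \<sigma>2 a ghat g l k) =
       complex_of_real ((cmod (cdot (a l k) (b_vec P ghat g l k)))\<^sup>2) /
       ((\<Sum>r\<in>UNIV. cdot (a r k) (C_mat P ghat g l k k *v a r k))
        - complex_of_real ((cmod (cdot (a l k) (b_vec P ghat g l k)))\<^sup>2)
        + (\<Sum>r\<in>UNIV. \<Sum>k'\<in>UNIV - {k}. cdot (a r k') (C_mat P ghat g l k k' *v a r k'))
        + complex_of_real \<sigma>2) \<and>
     \<comment> \<open>the Bochner integrals default to 0, so existence of the expectations is stated separately\<close>
     (\<forall>r. integrable P (\<lambda>\<omega>. cdot (ghat r k \<omega>) (g l k r \<omega>))) \<and>
     (\<forall>k' r n. integrable P
        (\<lambda>\<omega>. cdot (ghat r k' \<omega>) (g l k r \<omega>) * cdot (g l k n \<omega>) (ghat n k' \<omega>))) \<and>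
     (\<forall>r. b_vec P ghat g l k $ r =
        complex_of_real (real \<tau>p * \<eta>) *
        trace (matrix_inv (\<Psi> r k) ** Rbar r k r ** Rbar l k r)) \<and>
     (\<forall>r. C_mat P ghat g l k k $ r $ r =
        complex_of_real ((real \<tau>p)\<^sup>2 * \<eta>\<^sup>2 *
          (cmod (trace (R l k r ** Rbar r k r ** matrix_inv (\<Psi> r k))))\<^sup>2)
        + complex_of_real (2 * (real \<tau>p)\<^sup>2 * \<eta>\<^sup>2 *
          Re (cdot (gbar l k r) ((Rbar r k r ** matrix_inv (\<Psi> r k)) *v gbar l k r) *
              trace (matrix_inv (\<Psi> r k) ** Rbar r k r ** R l k r)))
        + complex_of_real (real \<tau>p * \<eta>) *
          trace (Rbar r k r ** matrix_inv (\<Psi> r k) ** Rbar r k r ** Rbar l k r)) \<and>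
     (\<forall>r n. r \<noteq> n \<longrightarrow>
        C_mat P ghat g l k k $ r $ n = b_vec P ghat g l k $ r * cnj (b_vec P ghat g l k $ n)) \<and>
     (\<forall>k' r. k' \<noteq> k \<longrightarrow>
        C_mat P ghat g l k k' $ r $ r =
          complex_of_real (real \<tau>p * \<eta>) *
          trace (Rbar r k' r ** matrix_inv (\<Psi> r k') ** Rbar r k' r ** Rbar l k r)) \<and>
     (\<forall>k' r n. k' \<noteq> k \<longrightarrow> r \<noteq> n \<longrightarrow> C_mat P ghat g l k k' $ r $ n = 0)"
proof -
  \<comment> \<open>The pilot length is the cardinality of a nonempty finite type, hence
    positive.\<close>
  have "real \<tau>p * \<eta> > 0"
    using assms(2,4) by simp
  then interpret multicell P \<theta> gt g nt z ghat gbar R Rbar \<Psi> "real \<tau>p * \<eta>" \<sigma>2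
    using assms unfolding multicell_def multicell_axioms_def by blast
  have int: "integrable P (\<lambda>\<omega>. cdot (ghat r k' \<omega>) (g l k r \<omega>))" for k' r
    by (intro all_moments_integrable estimate_all_moments)
  have int2: "integrable P (\<lambda>\<omega>. cdot (ghat r k' \<omega>) (g l k r \<omega>) * cdot (g l k n \<omega>) (ghat n k' \<omega>))" for k' r n
    \<comment> \<open>The second factor is the conjugate of a useful signal, so the closure rules
      apply to the product.\<close>
    unfolding cdot_commute[of "g l k n _"]
    by (intro all_moments_integrable all_moments_intros estimate_all_moments)
  have off: "C_mat P ghat g l k k $ r $ n = b_vec P ghat g l k $ r * cnj (b_vec P ghat g l k $ n)" if "r \<noteq> n" for r n
    using C_mat_offdiag[OF that] by (simp add: b_vec_def)
  have off': "C_mat P ghat g l k k' $ r $ n = 0" if "k' \<noteq> k" "r \<noteq> n" for k' r n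
    using C_mat_offdiag[OF that(2)] by (simp add: estimate_other_mean[OF that(1)])
  show ?thesis
    using Rbar_eq Psi_eq SINR_expansion[OF estimate_all_moments] int int2 b_vec_eq
      C_mat_diag_same[unfolded power_mult_distrib] off C_mat_diag_other off'
    unfolding SE_def by (intro conjI allI impI refl) (simp_all only: mult.assoc)
qed

end
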